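(* Let $X$ be an $L$-space with a convexifying operator $P$, $T\subset\mathbb R^d$ ($d\in\mathbb N$) a convex compact set with the Euclidean metric $r$ and Lebesgue measure $\mu$, $\omega$ a modulus of continuity, $x_1,\dots,x_n\in T$, and $B_i$ the closed ball of radius $\varepsilon>0$ centered at $x_i$, with $B_i\subset T$, $i=1,\dots,n$. Consider the operator $f\mapsto P\circ f$ from $H^\omega(T,X)$ to $B(T,X)$ (with the uniform metric) and the information $$I(f)=\Big(\tfrac{1}{\mu(B_1)}\int_{B_1}f\,d\mu,\dots,\tfrac{1}{\mu(B_n)}\int_{B_n}f\,d\mu\Big).$$ Then $$\mathcal E(P,H^\omega(T,X),I,B(T,X))\le\max_{t\in T}\min_{i=1,\dots,n}\tfrac{1}{\mu(B_i)}\int_{B_i}\omega(r(t,s))\,d\mu(s).$$ If $X$ is isotropic and $X^{\rm inv}\cap X^{\rm c}\ne\{\theta\}$, then this inequality becomes an equality for all sufficiently small radii $\varepsilon>0$, and in this case the method $$\Phi^*(I(f))(t)=\sum_{i=1}^n\Big(\tfrac{1}{\mu(B_i)}\int_{B_i}f\,d\mu\Big)\chi_{T_i}(t)$$ is optimal, where $\tilde T_i=\{t\in T: r(t,x_i)\le r(t,x_j)\ \forall j\ne i\}$, $T_1=\tilde T_1$, $T_j=\tilde T_j\setminus\bigcup_{i=1}^{j-1}\tilde T_i$ for $j\ge2$, and $\chi_{T_i}(t)\,y$ means $y$ for $t\in T_i$ and $\theta$ otherwise.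
   Context: Semilinear space: a set $X$ with addition and multiplication by reals such that for all $x,y,z\in X$, $\alpha,\beta\in\mathbb R$: $x+y=y+x$; $x+(y+z)=(x+y)+z$; there is $\theta$ with $x+\theta=x$; $\alpha(x+y)=\alpha x+\alpha y$; $\alpha(\beta x)=(\alpha\beta)x$; $1\cdot x=x$, $0\cdot x=\theta$. $x$ convex: $(\alpha+\beta)x=\alpha x+\beta x$ for $\alpha,\beta\ge0$ ($X^{\rm c}$); invertible: $x+x'=\theta$ for some $x'$ ($X^{\rm inv}$). $L$-space: semilinear space with complete separable metric $h_X$, $h_X(\alpha x,\alpha y)=|\alpha|h_X(x,y)$, $h_X(x+z,y+z)\le h_X(x,y)$; isotropic if always equality. Convexifying operator: surjective $P\colon X\to X^{\rm c}$ with $h_X(P(x),P(y))\le h_X(x,y)$, $P\circ P=P$, $P(\alpha x+\beta y)=\alpha P(x)+\beta P(y)$. Integral: $f\colon T\to X$ measurable if $h_X(f(\cdot),x)$ is Borel measurable for all $x$; $B(T,X)$ is the set of bounded measurable functions with metric $h_{B(T,X)}(f,g)=\sup_{t\in T}h_X(f(t),g(t))$; for simple bounded $f$ with values $f_i$ on disjoint Borel $T_i$ covering $T$, $\int_Tf\,d\mu=\sum_iP(f_i)\mu(T_i)$; for bounded measurable $f$, the limit of integrals of any uniformly bounded sequence of simple functions converging a.e. to $f$; $\int_Qf\,d\mu=\int_T\chi_Qf\,d\mu$. Modulus of continuity: non-decreasing continuous $\omega\colon[0,\infty)\to[0,\infty)$, $\omega(0)=0$, $\omega(a+b)\le\omega(a)+\omega(b)$;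 $H^\omega(T,X)=\{f: h_X(f(s),f(t))\le\omega(r(s,t))\}$. Optimal recovery: a method is any map $\Phi$ from values of $I$ to $B(T,X)$; its error is $\sup_{f\in H^\omega(T,X)}h_{B(T,X)}(P\circ f,\Phi(I(f)))$; $\mathcal E(P,H^\omega(T,X),I,B(T,X))$ is the infimum over all methods; $\Phi^*$ is optimal if it attains it. *)

theory Defs
  imports "HOL-Analysis.Analysis"
begin

text \<open>A semilinear space with a metric, bundled as a record: addition, multiplication
  by reals, the neutral element theta, and the metric h_X.  The carrier is the whole type.\<close>

record 'x slspace =
  sadd :: "'x \<Rightarrow> 'x \<Rightarrow> 'x"
  smul :: "real \<Rightarrow> 'x \<Rightarrow> 'x"
  szero :: 'x
  hX :: "'x \<Rightarrow> 'x \<Rightarrow> real"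

definition semilinear_space :: "('x, 'm) slspace_scheme \<Rightarrow> bool" where
  "semilinear_space X \<longleftrightarrow>
     (\<forall>x y. sadd X x y = sadd X y x) \<and>
     (\<forall>x y z. sadd X x (sadd X y z) = sadd X (sadd X x y) z) \<and>
     (\<forall>x. sadd X x (szero X) = x) \<and>
     (\<forall>a x y. smul X a (sadd X x y) = sadd X (smul X a x) (smul X a y)) \<and>
     (\<forall>a b x. smul X a (smul X b x) = smul X (a * b) x) \<and>
     (\<forall>x. smul X 1 x = x) \<and>
     (\<forall>x. smul X 0 x = szero X)"

definition convex_elt :: "('x, 'm) slspace_scheme \<Rightarrow> 'x \<Rightarrow> bool" where
  "convex_elt X x \<longleftrightarrow>
     (\<forall>a b. a \<ge> 0 \<longrightarrow> b \<ge> 0 \<longrightarrow> smul X (a + b) x = sadd X (smul X a x) (smul X b x))"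

definition invertible_elt :: "('x, 'm) slspace_scheme \<Rightarrow> 'x \<Rightarrow> bool" where
  "invertible_elt X x \<longleftrightarrow> (\<exists>x'. sadd X x x' = szero X)"

definition Xc :: "('x, 'm) slspace_scheme \<Rightarrow> 'x set" where
  "Xc X = {x. convex_elt X x}"

definition Xinv :: "('x, 'm) slspace_scheme \<Rightarrow> 'x set" where
  "Xinv X = {x. invertible_elt X x}"

definition hconv :: "('x, 'm) slspace_scheme \<Rightarrow> (nat \<Rightarrow> 'x) \<Rightarrow> 'x \<Rightarrow> bool" where
  "hconv X s l \<longleftrightarrow> (\<lambda>k. hX X (s k) l) \<longlonglongrightarrow> 0"

definition is_metric :: "('x \<Rightarrow> 'x \<Rightarrow> real) \<Rightarrow> bool" where
  "is_metric h \<longleftrightarrow> (\<forall>x y. h x y = 0 \<longleftrightarrow> x = y) \<and> (\<forall>x y. h x y = h y x) \<and>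
     (\<forall>x y z. h x z \<le> h x y + h y z)"

definition complete_h :: "('x \<Rightarrow> 'x \<Rightarrow> real) \<Rightarrow> bool" where
  "complete_h h \<longleftrightarrow> (\<forall>s. (\<forall>e>0. \<exists>N. \<forall>m\<ge>N. \<forall>k\<ge>N. h (s m) (s k) < e)
      \<longrightarrow> (\<exists>l. (\<lambda>k. h (s k) l) \<longlonglongrightarrow> 0))"

definition separable_h :: "('x \<Rightarrow> 'x \<Rightarrow> real) \<Rightarrow> bool" where
  "separable_h h \<longleftrightarrow> (\<exists>D. countable D \<and> (\<forall>x e. e > 0 \<longrightarrow> (\<exists>d\<in>D. h x d < e)))"

definition L_space :: "('x, 'm) slspace_scheme \<Rightarrow> bool" where
  "L_space X \<longleftrightarrow> semilinear_space X \<and> is_metric (hX X) \<and> complete_h (hX X) \<and>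
     separable_h (hX X) \<and>
     (\<forall>a x y. hX X (smul X a x) (smul X a y) = \<bar>a\<bar> * hX X x y) \<and>
     (\<forall>x y z. hX X (sadd X x z) (sadd X y z) \<le> hX X x y)"

definition isotropic :: "('x, 'm) slspace_scheme \<Rightarrow> bool" where
  "isotropic X \<longleftrightarrow> (\<forall>x y z. hX X (sadd X x z) (sadd X y z) = hX X x y)"

definition convexifying :: "('x, 'm) slspace_scheme \<Rightarrow> ('x \<Rightarrow> 'x) \<Rightarrow> bool" where
  "convexifying X P \<longleftrightarrow> range P = Xc X \<and>
     (\<forall>x y. hX X (P x) (P y) \<le> hX X x y) \<and> (\<forall>x. P (P x) = P x) \<and>
     (\<forall>a b x y. P (sadd X (smul X a x) (smul X b y)) = sadd X (smul X a (P x)) (smul X b (P y)))"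

text \<open>Finite sums in the semilinear space (well defined by commutativity/associativity).\<close>
definition ssum :: "('x, 'm) slspace_scheme \<Rightarrow> ('i \<Rightarrow> 'x) \<Rightarrow> 'i set \<Rightarrow> 'x" where
  "ssum X g A = Finite_Set.fold (\<lambda>i acc. sadd X (g i) acc) (szero X) A"

definition measurable_X :: "('x, 'm) slspace_scheme \<Rightarrow> 'a::euclidean_space set \<Rightarrow> ('a \<Rightarrow> 'x) \<Rightarrow> bool" where
  "measurable_X X T f \<longleftrightarrow> (\<forall>x. (\<lambda>t. hX X (f t) x) \<in> borel_measurable (restrict_space lborel T))"

definition bounded_X :: "('x, 'm) slspace_scheme \<Rightarrow> 'a set \<Rightarrow> ('a \<Rightarrow> 'x) \<Rightarrow> bool" where
  "bounded_X X T f \<longleftrightarrow> (\<exists>C. \<forall>t\<in>T. hX X (f t) (szero X) \<le> C)"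

definition BTX :: "('x, 'm) slspace_scheme \<Rightarrow> 'a::euclidean_space set \<Rightarrow> ('a \<Rightarrow> 'x) set" where
  "BTX X T = {f. measurable_X X T f \<and> bounded_X X T f}"

definition simple_X :: "'a set \<Rightarrow> ('a \<Rightarrow> 'x) \<Rightarrow> bool" where
  "simple_X T f \<longleftrightarrow> finite (f ` T)"

definition simple_integral ::
  "('x, 'm) slspace_scheme \<Rightarrow> ('x \<Rightarrow> 'x) \<Rightarrow> 'a::euclidean_space set \<Rightarrow> ('a \<Rightarrow> 'x) \<Rightarrow> 'x" where
  "simple_integral X P T f =
     ssum X (\<lambda>v. smul X (measure lborel {t\<in>T. f t = v}) (P v)) (f ` T)"

definition integral_X ::
  "('x, 'm) slspace_scheme \<Rightarrow> ('x \<Rightarrow> 'x) \<Rightarrow> 'a::euclidean_space set \<Rightarrow> ('a \<Rightarrow> 'x) \<Rightarrow> 'x" where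
  "integral_X X P T f = (THE I. \<forall>s::nat \<Rightarrow> 'a \<Rightarrow> 'x.
      (\<forall>k. s k \<in> BTX X T \<and> simple_X T (s k)) \<and>
      (\<exists>C. \<forall>k. \<forall>t\<in>T. hX X (s k t) (szero X) \<le> C) \<and>
      (AE t in lborel. t \<in> T \<longrightarrow> hconv X (\<lambda>k. s k t) (f t))
      \<longrightarrow> hconv X (\<lambda>k. simple_integral X P T (s k)) I)"

definition integral_on ::
  "('x, 'm) slspace_scheme \<Rightarrow> ('x \<Rightarrow> 'x) \<Rightarrow> 'a::euclidean_space set \<Rightarrow> 'a set \<Rightarrow> ('a \<Rightarrow> 'x) \<Rightarrow> 'x" where
  "integral_on X P T Q f = integral_X X P T (\<lambda>t. if t \<in> Q then f t else szero X)"

definition modulus_of_continuity :: "(real \<Rightarrow> real) \<Rightarrow> bool" where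
  "modulus_of_continuity \<omega> \<longleftrightarrow> mono_on {0..} \<omega> \<and> continuous_on {0..} \<omega> \<and> \<omega> 0 = 0 \<and>
     (\<forall>a\<ge>0. \<omega> a \<ge> 0) \<and> (\<forall>a\<ge>0. \<forall>b\<ge>0. \<omega> (a + b) \<le> \<omega> a + \<omega> b)"

definition H_omega ::
  "('x, 'm) slspace_scheme \<Rightarrow> (real \<Rightarrow> real) \<Rightarrow> 'a::metric_space set \<Rightarrow> ('a \<Rightarrow> 'x) set" where
  "H_omega X \<omega> T = {f. \<forall>s\<in>T. \<forall>t\<in>T. hX X (f s) (f t) \<le> \<omega> (dist s t)}"

text \<open>The information: averages over the balls B_i = cball (x i) eps, i < n
  (indices i >= n carry no information: value theta).\<close>
definition info ::
  "('x, 'm) slspace_scheme \<Rightarrow> ('x \<Rightarrow> 'x) \<Rightarrow> 'a::euclidean_space set \<Rightarrow> nat \<Rightarrow> (nat \<Rightarrow> 'a) \<Rightarrow> real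
    \<Rightarrow> ('a \<Rightarrow> 'x) \<Rightarrow> nat \<Rightarrow> 'x" where
  "info X P T n xs eps f i =
     (if i < n then smul X (1 / measure lborel (cball (xs i) eps))
                      (integral_on X P T (cball (xs i) eps) f)
      else szero X)"

definition hB :: "('x, 'm) slspace_scheme \<Rightarrow> 'a set \<Rightarrow> ('a \<Rightarrow> 'x) \<Rightarrow> ('a \<Rightarrow> 'x) \<Rightarrow> ereal" where
  "hB X T f g = (SUP t\<in>T. ereal (hX X (f t) (g t)))"

definition methods :: "('x, 'm) slspace_scheme \<Rightarrow> 'a::euclidean_space set
    \<Rightarrow> ((nat \<Rightarrow> 'x) \<Rightarrow> ('a \<Rightarrow> 'x)) set" where
  "methods X T = {\<Phi>. \<forall>y. \<Phi> y \<in> BTX X T}"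

definition method_error ::
  "('x, 'm) slspace_scheme \<Rightarrow> ('x \<Rightarrow> 'x) \<Rightarrow> (real \<Rightarrow> real) \<Rightarrow> 'a::euclidean_space set
    \<Rightarrow> (('a \<Rightarrow> 'x) \<Rightarrow> nat \<Rightarrow> 'x) \<Rightarrow> ((nat \<Rightarrow> 'x) \<Rightarrow> ('a \<Rightarrow> 'x)) \<Rightarrow> ereal" where
  "method_error X P \<omega> T I \<Phi> = (SUP f\<in>H_omega X \<omega> T. hB X T (P \<circ> f) (\<Phi> (I f)))"

definition optimal_error ::
  "('x, 'm) slspace_scheme \<Rightarrow> ('x \<Rightarrow> 'x) \<Rightarrow> (real \<Rightarrow> real) \<Rightarrow> 'a::euclidean_space set
    \<Rightarrow> (('a \<Rightarrow> 'x) \<Rightarrow> nat \<Rightarrow> 'x) \<Rightarrow> ereal" where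
  "optimal_error X P \<omega> T I = (INF \<Phi>\<in>methods X T. method_error X P \<omega> T I \<Phi>)"

definition Ttilde :: "'a::metric_space set \<Rightarrow> nat \<Rightarrow> (nat \<Rightarrow> 'a) \<Rightarrow> nat \<Rightarrow> 'a set" where
  "Ttilde T n xs i = {t\<in>T. \<forall>j<n. j \<noteq> i \<longrightarrow> dist t (xs i) \<le> dist t (xs j)}"

definition Tpart :: "'a::metric_space set \<Rightarrow> nat \<Rightarrow> (nat \<Rightarrow> 'a) \<Rightarrow> nat \<Rightarrow> 'a set" where
  "Tpart T n xs j = Ttilde T n xs j - (\<Union>i<j. Ttilde T n xs i)"

definition Phi_star :: "('x, 'm) slspace_scheme \<Rightarrow> 'a::metric_space set \<Rightarrow> nat \<Rightarrow> (nat \<Rightarrow> 'a)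
    \<Rightarrow> (nat \<Rightarrow> 'x) \<Rightarrow> 'a \<Rightarrow> 'x" where
  "Phi_star X T n xs y t = ssum X (\<lambda>i. if t \<in> Tpart T n xs i then y i else szero X) {..<n}"

definition bound_rhs :: "(real \<Rightarrow> real) \<Rightarrow> 'a::euclidean_space set \<Rightarrow> nat \<Rightarrow> (nat \<Rightarrow> 'a) \<Rightarrow> real \<Rightarrow> ereal" where
  "bound_rhs \<omega> T n xs eps = (SUP t\<in>T. ereal (Min ((\<lambda>i. (1 / measure lborel (cball (xs i) eps)) *
       integral (cball (xs i) eps) (\<lambda>s. \<omega> (dist t s))) ` {..<n})))"

end

theory Submission
  imports Defs
begin

text \<open>
  Upper bound: \<open>P (f t)\<close> is the mean over \<open>B\<^sub>i\<close> of the constant \<open>f t\<close>, so its distance to the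
  mean of \<open>f\<close> over \<open>B\<^sub>i\<close> is at most the mean over \<open>B\<^sub>i\<close> of \<open>\<omega> (dist t s)\<close>. This mean increases
  with the distance from \<open>t\<close> to the centre of the ball, as one sees by reflecting one ball to
  another in the bisecting hyperplane; hence the nearest centre is the best choice.

  Lower bound: an invertible convex element spans an isometric copy of the real line, on which the
  integral is the ordinary one. For fixed \<open>t\<close> let \<open>R\<close> be the least of the ball means. On each ball
  the truncation \<open>max (R - \<omega> (dist t s)) (- c)\<close> has mean zero for a suitable \<open>c \<ge> 0\<close>, and then it is
  bounded by \<open>\<omega> (2 * e)\<close>. For small radius \<open>e\<close> this is negligible against \<open>\<omega>\<close> at the distance of
  different balls, so these pieces together with the value \<open>R\<close> at \<open>t\<close> satisfy the modulus condition
  and extend to some \<open>\<phi>\<close> on the whole space. The information does not distinguish \<open>\<phi>\<close> from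
  \<open>- \<phi>\<close>, so every method errs by at least \<open>R\<close> at \<open>t\<close>.
\<close>

section \<open>Integrals over balls\<close>

text \<open>By the Vitali covering theorem an open set is, up to a null set, a disjoint union of balls,
  and an isometry preserves the volume of a ball.\<close>

lemma emeasure_lborel_vimage_isometry_le:
  fixes f :: "'a::euclidean_space \<Rightarrow> 'a"
  assumes inv: "\<And>x. f (f x) = x" and iso: "\<And>x y. dist (f x) (f y) = dist x y"
    and U: "open U"
  shows "emeasure lborel U \<le> emeasure lborel (f -` U)"
proof -
  have vim: "f -` cball a r = cball (f a) r" for a r
    using iso inv by (auto simp: dist_commute) (metis dist_commute)+
  have cont: "continuous_on UNIV f"
    by (rule continuous_onI) (use iso in fastforce)
  define K where "K = {(a, r). 0 < r \<and> cball a r \<subseteq> U}"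
  \<comment> \<open>Fineness of the cover, as Vitali's theorem demands: the radius is cut to
    \<open>d/2\<close> to lie strictly below \<open>d\<close>, and to \<open>e\<close> to stay
    inside \<open>U\<close>.\<close>
  have cov: "\<exists>i. i \<in> K \<and> x \<in> cball (fst i) (snd i) \<and> snd i < d" if "x \<in> U" "0 < d" for x d
  proof -
    obtain e where e: "e > 0" "cball x e \<subseteq> U"
      using U \<open>x \<in> U\<close> open_contains_cball by blast
    have "cball x (min e (d/2)) \<subseteq> U"
      using e by (meson min.cobounded1 order_trans subset_cball)
    then have "(x, min e (d/2)) \<in> K"
      using e that by (auto simp: K_def)
    then show ?thesis
      using e that by (intro exI[of _ "(x, min e (d/2))"]) auto
  qed
  obtain C where C: "countable C" "C \<subseteq> K"
    and dis: "pairwise (\<lambda>i j. disjnt (cball (fst i) (snd i)) (cball (fst j) (snd j))) C"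
    and neg: "negligible (U - (\<Union>i\<in>C. cball (fst i) (snd i)))"
    using Vitali_covering_theorem_cballs[of K snd U fst] cov K_def
    by (metis (no_types, lifting) case_prod_conv mem_Collect_eq prod.collapse)
  let ?B = "\<lambda>i. cball (fst i) (snd i)"
  have disj: "disjoint_family_on ?B C"
    using dis by (auto simp: disjoint_family_on_def pairwise_def disjnt_def)
  have meas: "(\<Union>i\<in>C. ?B i) \<in> sets borel"
    using C by (intro sets.countable_UN') auto
  have null: "U - (\<Union>i\<in>C. ?B i) \<in> null_sets lborel"
    using neg U meas by (simp add: negligible_iff_null_sets null_sets_completion_iff)
  have "emeasure lborel U \<le> emeasure lborel ((\<Union>i\<in>C. ?B i) \<union> (U - (\<Union>i\<in>C. ?B i)))"
    using meas U by (intro emeasure_mono) auto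
  also have "\<dots> = emeasure lborel (\<Union>i\<in>C. ?B i)"
    using null meas by (intro emeasure_Un_null_set) auto
  also have "\<dots> = (\<integral>\<^sup>+i. emeasure lborel (?B i) \<partial>count_space C)"
    using disj C by (intro emeasure_UN_countable) auto
  also have "\<dots> = (\<integral>\<^sup>+i. emeasure lborel (f -` ?B i) \<partial>count_space C)"
  proof (rule nn_integral_cong)
    fix i assume "i \<in> space (count_space C)"
    then have "0 \<le> snd i"
      using C by (auto simp: K_def)
    then show "emeasure lborel (?B i) = emeasure lborel (f -` ?B i)"
      by (simp add: vim emeasure_cball)
  qed
  also have "\<dots> = emeasure lborel (\<Union>i\<in>C. f -` ?B i)"
  proof (rule emeasure_UN_countable[symmetric])
    show "disjoint_family_on (\<lambda>i. f -` ?B i) C"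
      using disj unfolding disjoint_family_on_def by blast
  qed (use C in \<open>auto simp: vim\<close>)
  \<comment> \<open>The selected balls miss a null set of \<open>U\<close>, and nothing is known yet
    about the preimage of that null set; hence only an inequality.\<close>
  also have "\<dots> \<le> emeasure lborel (f -` U)"
  proof (rule emeasure_mono)
    show "(\<Union>i\<in>C. f -` ?B i) \<subseteq> f -` U"
      using C(2) unfolding K_def by fastforce
    show "f -` U \<in> sets lborel"
      using open_vimage[OF U cont] by (simp add: borel_open)
  qed
  finally show ?thesis .
qed

text \<open>The preceding inequality, applied to \<open>U\<close> and to its preimage, gives
  equality for open sets because \<open>f\<close> is its own inverse. Boxes are enough to identify
  Lebesgue measure.\<close>

lemma distr_lborel_involutive_isometry:
  fixes f :: "'a::euclidean_space \<Rightarrow> 'a"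
  assumes inv: "\<And>x. f (f x) = x" and iso: "\<And>x y. dist (f x) (f y) = dist x y"
  shows "distr lborel borel f = lborel"
proof -
  have cont: "continuous_on UNIV f"
    by (rule continuous_onI) (use iso in fastforce)
  then have [measurable]: "f \<in> borel_measurable borel"
    by (rule borel_measurable_continuous_onI)
  have eq: "emeasure lborel (f -` U) = emeasure lborel U" if U: "open U" for U
  proof (rule antisym)
    have "f -` f -` U = U"
      using inv by auto
    moreover have "open (f -` U)"
      using open_vimage[OF U] cont by simp
    ultimately show "emeasure lborel (f -` U) \<le> emeasure lborel U"
      using emeasure_lborel_vimage_isometry_le[OF inv iso, of "f -` U"] by simp
  qed (rule emeasure_lborel_vimage_isometry_le[OF inv iso U])
  have "lborel = distr lborel borel f"
  proof (rule lborel_eqI)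
    fix l u :: 'a assume "\<And>b. b \<in> Basis \<Longrightarrow> l \<bullet> b \<le> u \<bullet> b"
    then show "emeasure (distr lborel borel f) (box l u) = (\<Prod>b\<in>Basis. (u - l) \<bullet> b)"
      using eq[OF open_box[of l u]] by (simp add: emeasure_distr emeasure_lborel_box inner_diff_left)
  qed simp
  then show ?thesis ..
qed

section \<open>Reflection in the bisecting hyperplane of two points\<close>

definition bisector_reflection :: "'a::euclidean_space \<Rightarrow> 'a \<Rightarrow> 'a \<Rightarrow> 'a" where
  "bisector_reflection p q s =
     s - (2 * ((s - (p + q) /\<^sub>R 2) \<bullet> (q - p)) / ((q - p) \<bullet> (q - p))) *\<^sub>R (q - p)"

text \<open>The difference of the squared distances is
  \<open>2 * ((s - (p + q) /\<^sub>R 2) \<bullet> (q - p))\<close>. The sign of this inner product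
  therefore tells on which side of the bisecting hyperplane \<open>s\<close> lies.\<close>

lemma dist_le_iff_bisector:
  fixes s p q :: "'a::euclidean_space"
  shows "dist s p \<le> dist s q \<longleftrightarrow> (s - (p + q) /\<^sub>R 2) \<bullet> (q - p) \<le> 0"
proof -
  have "dist s p \<le> dist s q \<longleftrightarrow> (s - p) \<bullet> (s - p) \<le> (s - q) \<bullet> (s - q)"
    by (simp add: dist_norm norm_le)
  also have "\<dots> \<longleftrightarrow> (s - (p + q) /\<^sub>R 2) \<bullet> (q - p) \<le> 0"
    by (simp add: algebra_simps inner_commute) linarith
  finally show ?thesis .
qed

context
  fixes p q :: "'a::euclidean_space"
  assumes neq: "p \<noteq> q"
begin

lemma bisector_reflection_center: "bisector_reflection p q q = p"
proof -
  have "(q - (p + q) /\<^sub>R 2) \<bullet> (q - p) * 2 = (q - p) \<bullet> (q - p)"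
    by (simp add: algebra_simps inner_commute)
  moreover have "(q - p) \<bullet> (q - p) \<noteq> 0"
    using neq by simp
  ultimately show ?thesis
    by (simp add: bisector_reflection_def mult.commute)
qed

lemma bisector_reflection_side:
  "(bisector_reflection p q s - (p + q) /\<^sub>R 2) \<bullet> (q - p) = - ((s - (p + q) /\<^sub>R 2) \<bullet> (q - p))"
proof -
  have "(q - p) \<bullet> (q - p) \<noteq> 0"
    using neq by simp
  then show ?thesis
    unfolding bisector_reflection_def
    by (simp add: inner_diff_left[of _ _ "q - p"] inner_scaleR_left)
qed

lemma bisector_reflection_involutive: "bisector_reflection p q (bisector_reflection p q s) = s"
proof -
  let ?r = "bisector_reflection p q"
  have "?r (?r s) = ?r s - (2 * ((?r s - (p + q) /\<^sub>R 2) \<bullet> (q - p)) / ((q - p) \<bullet> (q - p))) *\<^sub>R (q - p)"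
    by (simp add: bisector_reflection_def)
  also have "\<dots> = s"
    unfolding bisector_reflection_side by (simp add: bisector_reflection_def)
  finally show ?thesis .
qed

text \<open>The metric properties of the reflection come from this one identity: the correction term
  is a product of the signed positions of \<open>s\<close> and \<open>z\<close> relative to the
  hyperplane.\<close>

lemma dist_bisector_reflection_sq:
  "(dist z (bisector_reflection p q s))\<^sup>2 = (dist z s)\<^sup>2
     + 4 * ((s - (p + q) /\<^sub>R 2) \<bullet> (q - p)) / ((q - p) \<bullet> (q - p)) * ((z - (p + q) /\<^sub>R 2) \<bullet> (q - p))"
proof -
  define v m where "v = q - p" and "m = (p + q) /\<^sub>R 2"
  define l where "l = 2 * ((s - m) \<bullet> v) / (v \<bullet> v)"
  have v: "v \<bullet> v \<noteq> 0"
    using neq by (simp add: v_def)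
  have "(dist z (bisector_reflection p q s))\<^sup>2 = (z - s + l *\<^sub>R v) \<bullet> (z - s + l *\<^sub>R v)"
    by (simp add: bisector_reflection_def dist_norm power2_norm_eq_inner l_def v_def m_def algebra_simps)
  also have "\<dots> = (z - s) \<bullet> (z - s) + 2 * l * ((z - s) \<bullet> v) + l * (l * (v \<bullet> v))"
    by (simp add: inner_add_left inner_add_right inner_commute algebra_simps)
  also have "l * (v \<bullet> v) = 2 * ((s - m) \<bullet> v)"
    using v by (simp add: l_def)
  also have "(z - s) \<bullet> (z - s) + 2 * l * ((z - s) \<bullet> v) + l * (2 * ((s - m) \<bullet> v))
      = (z - s) \<bullet> (z - s) + 2 * l * ((z - m) \<bullet> v)"
    by (simp add: inner_diff_left algebra_simps)
  finally show ?thesis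
    by (simp add: dist_norm power2_norm_eq_inner l_def v_def m_def)
qed

text \<open>Here \<open>s\<close> lies on the side of \<open>q\<close> and \<open>z\<close> on the
  side of \<open>p\<close>, so the correction term in the squared distance is not positive.\<close>

lemma dist_bisector_reflection_le:
  assumes "dist s q \<le> dist s p" "dist z p \<le> dist z q"
  shows "dist z (bisector_reflection p q s) \<le> dist z s"
proof -
  have "(s - (p + q) /\<^sub>R 2) \<bullet> (q - p) \<ge> 0"
  proof -
    have "(s - (q + p) /\<^sub>R 2) \<bullet> (p - q) \<le> 0"
      using assms(1) dist_le_iff_bisector by blast
    moreover have "(s - (q + p) /\<^sub>R 2) \<bullet> (p - q) = - ((s - (p + q) /\<^sub>R 2) \<bullet> (q - p))"
      by (metis add.commute inner_minus_right minus_diff_eq)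
    ultimately show ?thesis by simp
  qed
  moreover have "(z - (p + q) /\<^sub>R 2) \<bullet> (q - p) \<le> 0"
    using assms(2) dist_le_iff_bisector by blast
  ultimately have "4 * ((s - (p + q) /\<^sub>R 2) \<bullet> (q - p)) / ((q - p) \<bullet> (q - p))
      * ((z - (p + q) /\<^sub>R 2) \<bullet> (q - p)) \<le> 0"
    by (intro mult_nonneg_nonpos divide_nonneg_nonneg) auto
  then have "(dist z (bisector_reflection p q s))\<^sup>2 \<le> (dist z s)\<^sup>2"
    using dist_bisector_reflection_sq by simp
  then show ?thesis
    by (rule power2_le_imp_le) simp
qed

text \<open>Two uses of the squared-distance identity, first with \<open>y\<close> reflected and
  then with \<open>x\<close> reflected. The correction terms cancel because reflection reverses the
  signed position of \<open>x\<close>.\<close>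

lemma dist_bisector_reflection:
  "dist (bisector_reflection p q x) (bisector_reflection p q y) = dist x y"
proof -
  have "(dist (bisector_reflection p q x) (bisector_reflection p q y))\<^sup>2 = (dist x y)\<^sup>2"
    using dist_bisector_reflection_sq[of "bisector_reflection p q x" y]
      dist_bisector_reflection_sq[of y x]
    by (simp only: bisector_reflection_side) (simp add: dist_commute mult.commute)
  then show ?thesis
    by simp
qed

end

text \<open>The common part of the balls contributes equally to both sides. The reflection exchanges
  the two remaining crescents, and carrying a point of \<open>cball q e - cball p e\<close> to the
  side of \<open>p\<close>, where \<open>z\<close> lies, brings it no farther from \<open>z\<close>;
  monotonicity of \<open>w\<close> does the rest.\<close>

lemma integral_cball_dist_mono:
  fixes w :: "real \<Rightarrow> real" and z p q :: "'a::euclidean_space"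
  assumes mono: "mono_on {0..} w" and cont: "continuous_on {0..} w"
    and le: "dist z p \<le> dist z q"
  shows "integral (cball p e) (\<lambda>s. w (dist z s)) \<le> integral (cball q e) (\<lambda>s. w (dist z s))"
proof (cases "p = q")
  case neq: False
  let ?r = "bisector_reflection p q"
  let ?w = "\<lambda>s. w (dist z s)"
  note r = bisector_reflection_involutive[OF neq] dist_bisector_reflection[OF neq]
  have wcont: "continuous_on S ?w" for S
    by (rule continuous_on_compose2[OF cont]) (auto intro!: continuous_intros)
  have int: "set_integrable lborel (cball c e) ?w" for c
    unfolding set_integrable_def by (rule borel_integrable_compact[OF compact_cball wcont])
  have wmeas [measurable]: "?w \<in> borel_measurable borel"
    by (rule borel_measurable_continuous_onI[OF wcont])
  have rq: "?r q = p" and rp: "?r p = q"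
    using bisector_reflection_center[OF neq] r(1)[of q] by auto
  have rcont: "continuous_on UNIV ?r"
    by (rule continuous_onI) (use r(2) in fastforce)
  have [measurable]: "?r \<in> borel_measurable borel"
    by (rule borel_measurable_continuous_onI[OF rcont])
  have mem: "?r s \<in> cball p e \<longleftrightarrow> s \<in> cball q e" "?r s \<in> cball q e \<longleftrightarrow> s \<in> cball p e" for s
    using r(2)[of s q] r(2)[of s p] rp rq by (auto simp: dist_commute)
  let ?D = "cball p e - cball q e" and ?E = "cball q e - cball p e" and ?I = "cball p e \<inter> cball q e"
  have intD: "set_integrable lborel A ?w" if "A = ?D \<or> A = ?E \<or> A = ?I" for A
    using that by (auto intro: set_integrable_subset[OF int[of p]] set_integrable_subset[OF int[of q]])
  have split: "(LINT s:cball p e|lborel. ?w s) = (LINT s:?I|lborel. ?w s) + (LINT s:?D|lborel. ?w s)"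
     "(LINT s:cball q e|lborel. ?w s) = (LINT s:?I|lborel. ?w s) + (LINT s:?E|lborel. ?w s)"
  proof -
    have "cball p e = ?I \<union> ?D" "cball q e = ?I \<union> ?E"
      by auto
    moreover have "?I \<inter> ?D = {}" "?I \<inter> ?E = {}"
      by auto
    ultimately show
      "(LINT s:cball p e|lborel. ?w s) = (LINT s:?I|lborel. ?w s) + (LINT s:?D|lborel. ?w s)"
      "(LINT s:cball q e|lborel. ?w s) = (LINT s:?I|lborel. ?w s) + (LINT s:?E|lborel. ?w s)"
      using set_integral_Un[of ?I ?D lborel ?w] set_integral_Un[of ?I ?E lborel ?w] intD by auto
  qed
  have [measurable]: "(\<lambda>s. indicator ?D s *\<^sub>R ?w s) \<in> borel_measurable borel"
    by (intro borel_measurable_scaleR borel_measurable_indicator sets.Diff wmeas) auto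
  \<comment> \<open>Lebesgue measure is its own image under the reflection; writing it so turns the
    next step into a change of variables.\<close>
  have "(LINT s:?D|lborel. ?w s) = (LINT s|distr lborel borel ?r. indicator ?D s *\<^sub>R ?w s)"
    unfolding distr_lborel_involutive_isometry[OF r] set_lebesgue_integral_def ..
  also have "\<dots> = (LINT s|lborel. indicator ?D (?r s) *\<^sub>R ?w (?r s))"
    by (subst integral_distr) measurable
  also have "\<dots> = (LINT s:?E|lborel. ?w (?r s))"
    unfolding set_lebesgue_integral_def
    by (rule Bochner_Integration.integral_cong) (auto simp: indicator_def mem simp del: mem_cball)
  also have "\<dots> \<le> (LINT s:?E|lborel. ?w s)"
  proof (rule set_integral_mono)
    have "integrable (distr lborel borel ?r) (\<lambda>s. indicator ?D s *\<^sub>R ?w s)"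
      unfolding distr_lborel_involutive_isometry[OF r] using intD[of ?D] by (simp add: set_integrable_def)
    then have "integrable lborel (\<lambda>s. indicator ?D (?r s) *\<^sub>R ?w (?r s))"
      by (subst (asm) integrable_distr_eq) measurable
    moreover have "(\<lambda>s. indicator ?D (?r s) *\<^sub>R ?w (?r s)) = (\<lambda>s. indicator ?E s *\<^sub>R ?w (?r s))"
      by (rule ext) (auto simp: indicator_def mem simp del: mem_cball)
    ultimately show "set_integrable lborel ?E (\<lambda>s. ?w (?r s))"
      by (simp add: set_integrable_def)
    fix s assume "s \<in> ?E"
    then have "dist s q \<le> dist s p"
      by (auto simp: dist_commute)
    then have "dist z (?r s) \<le> dist z s"
      by (rule dist_bisector_reflection_le[OF neq _ le])
    then show "?w (?r s) \<le> ?w s"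
      using mono by (auto simp: mono_on_def)
  qed (auto intro: intD)
  finally have "(LINT s:cball p e|lborel. ?w s) \<le> (LINT s:cball q e|lborel. ?w s)"
    using split by simp
  then show ?thesis
    by (simp add: set_borel_integral_eq_integral(2)[OF int])
qed simp

section \<open>Moduli of continuity\<close>

lemma continuous_integrable_on_cball:
  fixes f :: "'a::euclidean_space \<Rightarrow> real"
  assumes "continuous_on (cball p e) f"
  shows "f integrable_on cball p e"
  using borel_integrable_compact[OF compact_cball assms]
  by (intro set_borel_integral_eq_integral(1)) (simp add: set_integrable_def)

lemma integral_const_cball:
  fixes p :: "'a::euclidean_space"
  shows "integral (cball p e) (\<lambda>_. c::real) = c * measure lborel (cball p e)"
proof -
  have "set_integrable lborel (cball p e) (\<lambda>_. c)"
    unfolding set_integrable_def by (intro borel_integrable_compact continuous_intros) simp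
  then have "integral (cball p e) (\<lambda>_. c) = (LINT x:cball p e|lborel. c)"
    by (rule set_borel_integral_eq_integral(2)[symmetric])
  also have "\<dots> = c * measure lborel (cball p e)"
    by (simp add: set_lebesgue_integral_def emeasure_lborel_cball_finite)
  finally show ?thesis .
qed

context
  fixes \<omega> :: "real \<Rightarrow> real"
  assumes om: "modulus_of_continuity \<omega>"
begin

lemma modulus_mono: "0 \<le> a \<Longrightarrow> a \<le> b \<Longrightarrow> \<omega> a \<le> \<omega> b"
  using om by (auto simp: modulus_of_continuity_def mono_on_def)

lemma modulus_nonneg: "0 \<le> a \<Longrightarrow> 0 \<le> \<omega> a"
  and modulus_zero: "\<omega> 0 = 0"
  and modulus_continuous: "continuous_on {0..} \<omega>"
  and modulus_subadd: "0 \<le> a \<Longrightarrow> 0 \<le> b \<Longrightarrow> \<omega> (a + b) \<le> \<omega> a + \<omega> b"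
  using om by (auto simp: modulus_of_continuity_def)

lemma modulus_triangle:
  fixes x y z :: "'a::metric_space"
  shows "\<omega> (dist x z) \<le> \<omega> (dist x y) + \<omega> (dist y z)"
  using modulus_mono[of "dist x z" "dist x y + dist y z"] modulus_subadd[of "dist x y" "dist y z"]
  by (simp add: dist_triangle)

lemma modulus_dist_continuous: "continuous_on S (\<lambda>s. \<omega> (dist t s))"
  by (rule continuous_on_compose2[OF modulus_continuous]) (auto intro!: continuous_intros)

lemma continuous_on_modulus:
  fixes u :: "'a::metric_space \<Rightarrow> real"
  assumes "\<And>s t. s \<in> T \<Longrightarrow> t \<in> T \<Longrightarrow> \<bar>u s - u t\<bar> \<le> \<omega> (dist s t)"
  shows "continuous_on T u"
  unfolding continuous_on_def
proof
  fix t assume t: "t \<in> T"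
  have "((\<lambda>s. \<omega> (dist t s)) \<longlongrightarrow> 0) (at t within T)"
    using modulus_dist_continuous[of T t] t by (auto simp: continuous_on_def modulus_zero)
  then have "((\<lambda>s. u s - u t) \<longlongrightarrow> 0) (at t within T)"
  proof (rule Lim_null_comparison[rotated])
    show "\<forall>\<^sub>F s in at t within T. norm (u s - u t) \<le> \<omega> (dist t s)"
      using assms t by (auto simp: eventually_at_filter dist_commute intro!: always_eventually)
  qed
  then show "(u \<longlongrightarrow> u t) (at t within T)"
    by (rule LIM_zero_cancel)
qed

text \<open>Subadditivity handles the multiples of \<open>a\<close>, and monotonicity covers
  everything below them. This settles the degenerate case in the choice of a small radius.\<close>

lemma modulus_eq_0:
  assumes "0 < a" "\<omega> a = 0" "0 \<le> x"
  shows "\<omega> x = 0"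
proof -
  obtain n :: nat where n: "x \<le> real n * a"
    using assms(1) by (metis ex_less_of_nat_mult less_imp_le)
  have "\<omega> (real n * a) \<le> 0"
  proof (induction n)
    case (Suc n)
    have "\<omega> (real (Suc n) * a) \<le> \<omega> (real n * a) + \<omega> a"
      using modulus_subadd[of "real n * a" a] assms(1) by (simp add: algebra_simps)
    then show ?case
      using Suc assms(2) by simp
  qed (simp add: modulus_zero)
  then show ?thesis
    using modulus_mono[OF assms(3) n] modulus_nonneg[OF assms(3)] by simp
qed

text \<open>Fixes how small the radius must be for centres at least \<open>\<delta>\<close> apart:
  points of different balls are then at least \<open>\<delta> / 2\<close> apart, and twice the
  oscillation allowed within a ball does not exceed the modulus at that distance. If
  \<open>\<omega>\<close> vanishes at \<open>\<delta> / 2\<close>, only the first condition matters;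
  otherwise continuity at 0 supplies the second.\<close>

lemma modulus_small:
  assumes "0 < \<delta>"
  obtains \<eta> where "0 < \<eta>" "\<And>e. 0 < e \<Longrightarrow> e < \<eta> \<Longrightarrow> 4 * e \<le> \<delta> \<and> 2 * \<omega> (2 * e) \<le> \<omega> (\<delta> / 2)"
proof (cases "\<omega> (\<delta> / 2) = 0")
  case True
  then have "\<omega> (2 * e) = 0" if "0 < e" for e
    using modulus_eq_0[of "\<delta> / 2" "2 * e"] assms that by simp
  then show ?thesis
    using assms True by (intro that[of "\<delta> / 4"]) auto
next
  case False
  then have pos: "\<omega> (\<delta> / 2) / 2 > 0"
    using modulus_nonneg[of "\<delta> / 2"] assms by simp
  obtain d where d: "d > 0" "\<And>x. x \<in> {0..} \<Longrightarrow> dist x 0 < d \<Longrightarrow> dist (\<omega> x) (\<omega> 0) < \<omega> (\<delta> / 2) / 2"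
    using modulus_continuous pos unfolding continuous_on_iff by (metis atLeast_iff order_refl)
  have "4 * e \<le> \<delta> \<and> 2 * \<omega> (2 * e) \<le> \<omega> (\<delta> / 2)" if "0 < e" "e < min (\<delta> / 4) (d / 2)" for e
    using d(2)[of "2 * e"] that modulus_nonneg[of "2 * e"] by (auto simp: dist_real_def modulus_zero)
  then show ?thesis
    using assms d(1) by (intro that[of "min (\<delta> / 4) (d / 2)"]) auto
qed

text \<open>McShane's extension by an infimal convolution with \<open>\<omega>\<close>.\<close>

lemma modulus_extension:
  fixes u :: "'a::metric_space \<Rightarrow> real"
  assumes S: "S \<noteq> {}" and u: "\<And>a b. a \<in> S \<Longrightarrow> b \<in> S \<Longrightarrow> \<bar>u a - u b\<bar> \<le> \<omega> (dist a b)"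
  obtains \<phi> where "\<And>s s'. \<bar>\<phi> s - \<phi> s'\<bar> \<le> \<omega> (dist s s')" "\<And>a. a \<in> S \<Longrightarrow> \<phi> a = u a"
proof -
  define \<phi> where "\<phi> s = (INF a\<in>S. u a + \<omega> (dist a s))" for s
  have bdd: "bdd_below ((\<lambda>a. u a + \<omega> (dist a s)) ` S)" for s
  proof -
    obtain b where b: "b \<in> S"
      using S by auto
    have "u b - \<omega> (dist b s) \<le> u a + \<omega> (dist a s)" if "a \<in> S" for a
      using u[OF that b] modulus_triangle[of a b s] by (simp add: dist_commute abs_le_iff)
    then show ?thesis
      by (auto intro!: bdd_belowI2)
  qed
  have le: "\<phi> s \<le> \<phi> s' + \<omega> (dist s s')" for s s'
  proof -
    have "\<phi> s - \<omega> (dist s s') \<le> \<phi> s'"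
      unfolding \<phi>_def[of s']
    proof (rule cINF_greatest[OF S])
      fix a assume "a \<in> S"
      then have "\<phi> s \<le> u a + \<omega> (dist a s)"
        unfolding \<phi>_def by (rule cINF_lower[OF bdd])
      then show "\<phi> s - \<omega> (dist s s') \<le> u a + \<omega> (dist a s')"
        using modulus_triangle[of a s s'] by (simp add: dist_commute)
    qed
    then show ?thesis
      by simp
  qed
  have "\<bar>\<phi> s - \<phi> s'\<bar> \<le> \<omega> (dist s s')" for s s'
    using le[of s s'] le[of s' s] by (simp add: dist_commute abs_le_iff)
  moreover have "\<phi> a = u a" if a: "a \<in> S" for a
  proof (rule antisym)
    show "\<phi> a \<le> u a"
      using cINF_lower[OF bdd a, of a] by (simp add: \<phi>_def modulus_zero)
    show "u a \<le> \<phi> a"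
      unfolding \<phi>_def
    proof (rule cINF_greatest[OF S])
      fix b assume "b \<in> S"
      then show "u a \<le> u b + \<omega> (dist b a)"
        using u[OF a, of b] by (simp add: dist_commute abs_le_iff)
    qed
  qed
  ultimately show ?thesis
    by (rule that)
qed

text \<open>At \<open>c = 0\<close> the integrand is nonnegative. For large \<open>c\<close> the cut
  is inactive and the integral becomes that of \<open>R - \<omega> (dist t s)\<close>, which the
  second assumption makes nonpositive. The intermediate value theorem gives a level in
  between.\<close>

lemma truncation_mean_zero:
  fixes t p :: "'a::euclidean_space"
  assumes R: "0 \<le> R" "R * measure lborel (cball p e) \<le> integral (cball p e) (\<lambda>s. \<omega> (dist t s))"
  obtains c where "0 \<le> c" "integral (cball p e) (\<lambda>s. max (R - \<omega> (dist t s)) (- c)) = 0"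
proof -
  let ?B = "cball p e"
  let ?F = "\<lambda>c. integral ?B (\<lambda>s. max (R - \<omega> (dist t s)) (- c))"
  let ?\<mu> = "measure lborel ?B"
  have int: "(\<lambda>s. max (R - \<omega> (dist t s)) (- c)) integrable_on ?B" for c
    by (intro continuous_integrable_on_cball continuous_intros modulus_dist_continuous)
  have const: "integral ?B (\<lambda>s. c) = c * ?\<mu>" for c :: real
    by (rule integral_const_cball)
  have iconst: "(\<lambda>s. c::real) integrable_on ?B" for c
    by (intro continuous_integrable_on_cball continuous_intros)
  \<comment> \<open>Moving the level \<open>c\<close> changes the integrand by at most the same
    amount, so the integral is Lipschitz in \<open>c\<close>, hence continuous.\<close>
  have lip: "?F c \<le> ?F c' + \<bar>c - c'\<bar> * ?\<mu>" for c c'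
  proof -
    have "?F c \<le> integral ?B (\<lambda>s. max (R - \<omega> (dist t s)) (- c') + \<bar>c - c'\<bar>)"
      by (intro integral_le int integrable_add iconst) auto
    also have "\<dots> = ?F c' + \<bar>c - c'\<bar> * ?\<mu>"
      by (subst integral_add[OF int iconst]) (simp only: const)
    finally show ?thesis .
  qed
  have cont: "continuous_on {0..C} ?F" for C
  proof (rule lipschitz_on_continuous_on[of ?\<mu>], rule lipschitz_onI)
    fix c c'
    show "dist (?F c) (?F c') \<le> ?\<mu> * dist c c'"
      using lip[of c c'] lip[of c' c] by (simp add: dist_real_def abs_le_iff mult.commute abs_minus_commute)
  qed simp
  \<comment> \<open>A bound for \<open>\<omega> (dist t s)\<close> on the ball, so that cutting at
    \<open>- C\<close> has no effect. The \<open>max\<close> keeps the argument nonnegative for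
    every sign of \<open>e\<close>.\<close>
  define C where "C = \<omega> (dist t p + max e 0)"
  have C: "0 \<le> C"
    unfolding C_def by (rule modulus_nonneg) simp
  have "0 \<le> ?F 0"
    by (intro integral_nonneg int) auto
  moreover have "?F C \<le> 0"
  proof -
    have "?F C = integral ?B (\<lambda>s. R - \<omega> (dist t s))"
    proof (rule integral_cong)
      fix s assume "s \<in> ?B"
      then have "dist t s \<le> dist t p + max e 0"
        using dist_triangle[of t s p] by simp
      then have "\<omega> (dist t s) \<le> C"
        unfolding C_def by (intro modulus_mono) auto
      then show "max (R - \<omega> (dist t s)) (- C) = R - \<omega> (dist t s)"
        using R(1) by simp
    qed
    also have "\<dots> = R * ?\<mu> - integral ?B (\<lambda>s. \<omega> (dist t s))"
      by (subst integral_diff[OF iconst]) (auto simp: const intro!: continuous_integrable_on_cball modulus_dist_continuous)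
    finally show ?thesis
      using R(2) by simp
  qed
  ultimately obtain c where "0 \<le> c" "?F c = 0"
    using IVT2'[of ?F C 0 0] C cont by auto
  then show ?thesis
    by (rule that)
qed

text \<open>The prescribed values on the balls and at \<open>t\<close> satisfy the modulus condition
  on their union, so they extend. The centres form a set \<open>K\<close>, not an indexed family, so
  that coinciding sample points cause no conflict: distinct members are at least
  \<open>\<delta>\<close> apart.\<close>

lemma extremal_function:
  fixes t :: "'a::euclidean_space"
  assumes e: "0 < e" and R0: "0 \<le> R"
    and R: "\<And>p. p \<in> K \<Longrightarrow> R * measure lborel (cball p e) \<le> integral (cball p e) (\<lambda>s. \<omega> (dist t s))"
    and sep: "\<And>p q. p \<in> K \<Longrightarrow> q \<in> K \<Longrightarrow> p \<noteq> q \<Longrightarrow> \<delta> \<le> dist p q"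
    and small: "4 * e \<le> \<delta>" "2 * \<omega> (2 * e) \<le> \<omega> (\<delta> / 2)"
  obtains \<phi> where "\<And>s s'. \<bar>\<phi> s - \<phi> s'\<bar> \<le> \<omega> (dist s s')" "\<phi> t = R"
    "\<And>p. p \<in> K \<Longrightarrow> integral (cball p e) \<phi> = 0"
proof -
  have "\<exists>c. \<forall>p\<in>K. 0 \<le> c p \<and> integral (cball p e) (\<lambda>s. max (R - \<omega> (dist t s)) (- c p)) = 0"
    by (rule bchoice) (metis truncation_mean_zero[OF R0 R])
  then obtain c where c: "\<And>p. p \<in> K \<Longrightarrow> 0 \<le> c p"
    "\<And>p. p \<in> K \<Longrightarrow> integral (cball p e) (\<lambda>s. max (R - \<omega> (dist t s)) (- c p)) = 0"
    by blast
  define v where "v p s = max (R - \<omega> (dist t s)) (- c p)" for p s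
  have v_diff: "\<bar>v p s - v p s'\<bar> \<le> \<omega> (dist s s')" for p s s'
  proof -
    have "\<bar>v p s - v p s'\<bar> \<le> \<bar>\<omega> (dist t s) - \<omega> (dist t s')\<bar>"
      by (auto simp: v_def)
    also have "\<dots> \<le> \<omega> (dist s s')"
      using modulus_triangle[of t s s'] modulus_triangle[of t s' s] by (simp add: dist_commute abs_le_iff)
    finally show ?thesis .
  qed
  \<comment> \<open>A function with mean zero whose oscillation on the ball is at most
    \<open>\<omega> (2 * e)\<close> cannot exceed this number in modulus: otherwise it would keep
    one sign.\<close>
  have v_small: "\<bar>v p s\<bar> \<le> \<omega> (2 * e)" if p: "p \<in> K" and s: "s \<in> cball p e" for p s
  proof -
    let ?B = "cball p e"
    have pos: "0 < measure lborel ?B"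
      by (rule content_cball_pos[OF e])
    have osc: "\<bar>v p s - v p s'\<bar> \<le> \<omega> (2 * e)" if s': "s' \<in> ?B" for s'
    proof -
      have "dist s s' \<le> 2 * e"
        using s s' dist_triangle2[of s s' p] by (simp add: dist_commute)
      then show ?thesis
        using v_diff[of p s s'] modulus_mono[of "dist s s'" "2 * e"] by simp
    qed
    have int: "v p integrable_on ?B"
      by (intro continuous_integrable_on_cball continuous_on_modulus v_diff)
    have iconst: "(\<lambda>s. a::real) integrable_on ?B" for a
      by (intro continuous_integrable_on_cball continuous_intros)
    have zero: "integral ?B (v p) = 0"
      using c(2)[OF p] by (simp add: v_def[abs_def])
    have "integral ?B (\<lambda>_. v p s - \<omega> (2 * e)) \<le> integral ?B (v p)"
      by (intro integral_le iconst int) (use osc in \<open>force simp: abs_le_iff\<close>)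
    then have "v p s - \<omega> (2 * e) \<le> 0"
      using zero pos by (simp add: integral_const_cball mult_le_0_iff)
    moreover have "integral ?B (v p) \<le> integral ?B (\<lambda>_. v p s + \<omega> (2 * e))"
      by (intro integral_le iconst int) (use osc in \<open>force simp: abs_le_iff\<close>)
    then have "0 \<le> v p s + \<omega> (2 * e)"
      using zero pos by (simp add: integral_const_cball zero_le_mult_iff)
    ultimately show ?thesis
      by (simp add: abs_le_iff)
  qed
  \<comment> \<open>The balls are disjoint, because two radii add up to
    \<open>2 * e < \<delta>\<close>; for a point of a ball the choice therefore returns the only
    possible centre.\<close>
  define ctr where "ctr s = (SOME p. p \<in> K \<and> s \<in> cball p e)" for s
  have ctr_eq: "ctr s = p" if "p \<in> K" "s \<in> cball p e" for s p
  proof -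
    have "ctr s \<in> K \<and> s \<in> cball (ctr s) e"
      unfolding ctr_def by (rule someI[of _ p]) (use that in simp)
    then have "\<not> \<delta> \<le> dist (ctr s) p"
      using that small(1) e dist_triangle2[of "ctr s" p s] by (simp add: dist_commute)
    then show ?thesis
      using sep that \<open>ctr s \<in> K \<and> _\<close> by blast
  qed
  define U where "U = (\<Union>p\<in>K. cball p e)"
  \<comment> \<open>Off the balls only the value at \<open>t\<close> will matter. If
    \<open>t\<close> lies in a ball, the truncation takes the value \<open>R\<close> there too,
    because \<open>\<omega> 0 = 0\<close> and both \<open>R\<close> and \<open>c\<close> are
    nonnegative.\<close>
  define u where "u s = (if s \<in> U then v (ctr s) s else R)" for s
  have u_ball: "u s = v p s" if "p \<in> K" "s \<in> cball p e" for p s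
    using ctr_eq[OF that] that by (auto simp: u_def U_def)
  have u_t: "u t = R"
  proof (cases "t \<in> U")
    case True
    then obtain p where p: "p \<in> K" "t \<in> cball p e"
      by (auto simp: U_def)
    then show ?thesis
      using u_ball[OF p] c(1)[OF p(1)] R0 by (simp add: v_def modulus_zero)
  qed (simp add: u_def)
  \<comment> \<open>\<open>R - v p s\<close> is the smaller of \<open>\<omega> (dist t s)\<close>
    and \<open>R + c p\<close>, both nonnegative.\<close>
  have uR: "\<bar>R - u s\<bar> \<le> \<omega> (dist t s)" if s: "s \<in> U" for s
  proof -
    obtain p where p: "p \<in> K" "s \<in> cball p e"
      using s by (auto simp: U_def)
    then show ?thesis
      using u_ball[OF p] c(1)[OF p(1)] R0 modulus_nonneg[of "dist t s"] by (auto simp: v_def)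
  qed
  have u_diff: "\<bar>u a - u b\<bar> \<le> \<omega> (dist a b)" if ab: "a \<in> insert t U" "b \<in> insert t U" for a b
  proof (cases "a = t \<or> b = t")
    case True
    then show ?thesis
      using ab uR[of a] uR[of b] u_t by (auto simp: modulus_zero dist_commute abs_minus_commute)
  next
    case False
    then obtain p q where p: "p \<in> K" "a \<in> cball p e" and q: "q \<in> K" "b \<in> cball q e"
      using ab by (auto simp: U_def)
    show ?thesis
    proof (cases "p = q")
      case True
      then show ?thesis
        using u_ball[OF p] u_ball[OF q] v_diff by simp
    next
      case False
      have "dist p q \<le> dist p a + dist a b + dist b q"
        using dist_triangle[of p q a] dist_triangle[of a q b] by simp
      \<comment> \<open>The two radii use up at most \<open>2 * e \<le> \<delta> / 2\<close> of the
        distance between the centres.\<close>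
      then have "\<delta> / 2 \<le> dist a b"
        using sep[OF p(1) q(1) False] p(2) q(2) small(1) by (simp add: dist_commute)
      moreover have "0 \<le> \<delta> / 2"
        using small(1) e by simp
      ultimately have "\<omega> (\<delta> / 2) \<le> \<omega> (dist a b)"
        by (intro modulus_mono)
      then show ?thesis
        using v_small[OF p] v_small[OF q] u_ball[OF p] u_ball[OF q] small(2) by linarith
    qed
  qed
  obtain \<phi> where \<phi>: "\<And>s s'. \<bar>\<phi> s - \<phi> s'\<bar> \<le> \<omega> (dist s s')" "\<And>a. a \<in> insert t U \<Longrightarrow> \<phi> a = u a"
    using modulus_extension[of "insert t U" u] u_diff by blast
  show ?thesis
  proof (rule that[OF \<phi>(1)])
    show "\<phi> t = R"
      using \<phi>(2)[of t] u_t by simp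
    fix p assume p: "p \<in> K"
    have "integral (cball p e) \<phi> = integral (cball p e) (v p)"
    proof (rule integral_cong)
      fix s assume "s \<in> cball p e"
      then show "\<phi> s = v p s"
        using p \<phi>(2)[of s] u_ball[of p s] by (auto simp: U_def)
    qed
    then show "integral (cball p e) \<phi> = 0"
      using c(2)[OF p] by (simp add: v_def[abs_def])
  qed
qed

end

section \<open>The integral in an L-space\<close>

lemma compact_borel: "compact (T::'a::euclidean_space set) \<Longrightarrow> T \<in> sets borel"
  by (simp add: borel_closed compact_imp_closed)

lemma borel_measurable_restrict_lborel:
  fixes u :: "'a::euclidean_space \<Rightarrow> real"
  assumes "continuous_on T u"
  shows "u \<in> borel_measurable (restrict_space lborel T)"
proof -
  have "u \<in> borel_measurable (restrict_space borel T)"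
    using assms by (rule borel_measurable_continuous_on_restrict)
  then show ?thesis
    by (simp cong: measurable_cong_sets sets_restrict_space_cong)
qed

lemma compact_subset_measure_finite:
  fixes T A :: "'a::euclidean_space set"
  assumes "compact T" "A \<subseteq> T"
  shows "emeasure lborel A < \<infinity>"
  using assms by (meson bounded_subset compact_imp_bounded emeasure_bounded_finite)

lemma set_integrable_bounded_compact:
  fixes u :: "'a::euclidean_space \<Rightarrow> real"
  assumes u: "u \<in> borel_measurable (restrict_space lborel T)" and T: "compact T"
    and C: "\<And>t. t \<in> T \<Longrightarrow> \<bar>u t\<bar> \<le> C"
  shows "set_integrable lborel T u"
proof -
  have T': "T \<in> sets borel"
    using T by (simp add: borel_closed compact_imp_closed)
  have "integrable lborel (\<lambda>t. indicator T t *\<^sub>R C)"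
    using T compact_subset_measure_finite[OF T, of T] T'
    by (intro integrable_scaleR_left) (auto simp: integrable_indicator_iff)
  moreover have "(\<lambda>t. indicator T t *\<^sub>R u t) \<in> borel_measurable lborel"
    using u T' by (simp add: borel_measurable_restrict_space_iff mult.commute)
  ultimately show ?thesis
    unfolding set_integrable_def
    by (rule Bochner_Integration.integrable_bound) (use C in \<open>force simp: indicator_def\<close>)
qed

text \<open>On a Borel set this agrees, for values in the space, with being simple and a member of
  \<open>BTX\<close>. It makes no reference to a metric on the values, so it also applies to pairs,
  truth values, integers and reals.\<close>

definition msimple :: "'a::euclidean_space set \<Rightarrow> ('a \<Rightarrow> 'b) \<Rightarrow> bool" where
  "msimple T f \<longleftrightarrow> finite (f ` T) \<and> (\<forall>v. {t\<in>T. f t = v} \<in> sets borel)"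

lemma msimple_finite: "msimple T f \<Longrightarrow> finite (f ` T)"
  and msimple_sets: "msimple T f \<Longrightarrow> {t\<in>T. f t = v} \<in> sets borel"
  by (auto simp: msimple_def)

lemma msimple_Pair:
  assumes "msimple T f" "msimple T g"
  shows "msimple T (\<lambda>t. (f t, g t))"
proof -
  have "(\<lambda>t. (f t, g t)) ` T \<subseteq> f ` T \<times> g ` T"
    by auto
  then have "finite ((\<lambda>t. (f t, g t)) ` T)"
    using assms by (meson finite_SigmaI finite_subset msimple_finite)
  moreover have "{t\<in>T. (f t, g t) = v} = {t\<in>T. f t = fst v} \<inter> {t\<in>T. g t = snd v}" for v
    by auto
  ultimately show ?thesis
    using assms by (auto simp: msimple_def)
qed

lemma msimple_comp:
  assumes p: "msimple T p"
  shows "msimple T (\<lambda>t. F (p t))"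
proof -
  have "(\<lambda>t. F (p t)) ` T = F ` p ` T"
    by auto
  moreover have "{t\<in>T. F (p t) = v} = (\<Union>w\<in>{w \<in> p ` T. F w = v}. {t\<in>T. p t = w})" for v
    by auto
  moreover have "(\<Union>w\<in>{w \<in> p ` T. F w = v}. {t\<in>T. p t = w}) \<in> sets borel" for v
    using p by (intro sets.finite_UN) (auto simp: msimple_def)
  ultimately show ?thesis
    using p by (simp add: msimple_def)
qed

lemma msimple_const: "T \<in> sets borel \<Longrightarrow> msimple T (\<lambda>t. c)"
  by (auto simp: msimple_def intro: finite_subset[of _ "{c}"])

lemma msimple_If:
  assumes "msimple T f" "msimple T g" "{t\<in>T. Q t} \<in> sets borel"
  shows "msimple T (\<lambda>t. if Q t then f t else g t)"
proof -
  have "finite ((\<lambda>t. if Q t then f t else g t) ` T)"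
    by (rule finite_subset[of _ "f ` T \<union> g ` T"]) (use assms in \<open>auto simp: msimple_def\<close>)
  moreover have "{t\<in>T. (if Q t then f t else g t) = v}
      = ({t\<in>T. f t = v} \<inter> {t\<in>T. Q t}) \<union> ({t\<in>T. g t = v} - {t\<in>T. Q t})" for v
    by auto
  ultimately show ?thesis
    using assms by (auto simp: msimple_def)
qed

text \<open>A finite sum over the values of \<open>p\<close>, weighted by indicators of level sets.
  It yields measurability of the distance between a measurable and a simple function from
  measurability of distances to fixed points.\<close>

lemma msimple_apply_measurable:
  fixes G :: "'b \<Rightarrow> 'a::euclidean_space \<Rightarrow> real"
  assumes p: "msimple T p"
    and G: "\<And>v. v \<in> p ` T \<Longrightarrow> G v \<in> borel_measurable (restrict_space lborel T)"
    and T: "T \<in> sets borel"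
  shows "(\<lambda>t. G (p t) t) \<in> borel_measurable (restrict_space lborel T)"
proof -
  have eq: "G (p t) t = (\<Sum>v\<in>p ` T. indicator {t\<in>T. p t = v} t * G v t)" if "t \<in> T" for t
  proof -
    have "(\<Sum>v\<in>p ` T. indicator {t\<in>T. p t = v} t * G v t)
        = (\<Sum>v\<in>p ` T. if v = p t then G v t else 0)"
      by (rule sum.cong) (use that in auto)
    also have "\<dots> = G (p t) t"
      using that msimple_finite[OF p] by (simp add: sum.delta)
    finally show ?thesis ..
  qed
  have "(\<lambda>t. \<Sum>v\<in>p ` T. indicator {t\<in>T. p t = v} t * G v t)
      \<in> borel_measurable (restrict_space lborel T)"
  proof (intro borel_measurable_sum borel_measurable_times G)
    fix v
    show "(indicator {t\<in>T. p t = v} :: 'a \<Rightarrow> real) \<in> borel_measurable (restrict_space lborel T)"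
      by (rule measurable_restrict_space1) (use msimple_sets[OF p] in simp)
  qed
  then show ?thesis
    by (rule measurable_cong[THEN iffD1, rotated]) (use eq in \<open>auto simp: space_restrict_space\<close>)
qed

text \<open>The sum runs over the values of \<open>p\<close>, not over those of \<open>G\<close>;
  several integrands can then be evaluated over one common partition.\<close>

lemma msimple_set_integral:
  fixes G :: "'b \<Rightarrow> real"
  assumes p: "msimple T p" and T: "compact (T::'a::euclidean_space set)"
  shows "set_integrable lborel T (\<lambda>t. G (p t))"
    and "(LINT t:T|lborel. G (p t)) = (\<Sum>w\<in>p ` T. measure lborel {t\<in>T. p t = w} * G w)"
proof -
  have eq: "indicator T t *\<^sub>R G (p t) = (\<Sum>w\<in>p ` T. indicator {t\<in>T. p t = w} t *\<^sub>R G w)" for t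
  proof (cases "t \<in> T")
    case True
    have "(\<Sum>w\<in>p ` T. indicator {t\<in>T. p t = w} t *\<^sub>R G w) = (\<Sum>w\<in>p ` T. if w = p t then G w else 0)"
      by (rule sum.cong) (use True in auto)
    then show ?thesis
      using True msimple_finite[OF p] by (simp add: sum.delta)
  qed auto
  have int: "integrable lborel (\<lambda>t. indicator {t\<in>T. p t = w} t *\<^sub>R G w)" for w
    using msimple_sets[OF p] compact_subset_measure_finite[OF T, of "{t\<in>T. p t = w}"]
    by (intro integrable_scaleR_left) (auto simp: integrable_indicator_iff)
  show "set_integrable lborel T (\<lambda>t. G (p t))"
    unfolding set_integrable_def eq by (intro Bochner_Integration.integrable_sum int)
  show "(LINT t:T|lborel. G (p t)) = (\<Sum>w\<in>p ` T. measure lborel {t\<in>T. p t = w} * G w)"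
    unfolding set_lebesgue_integral_def eq
    using int msimple_sets[OF p] by (subst Bochner_Integration.integral_sum) (auto intro!: sum.cong)
qed

lemma msimple_indicator:
  assumes "T \<in> sets borel" "Q \<in> sets borel"
  shows "msimple T (\<lambda>t. if t \<in> Q then x else y)"
proof (intro msimple_If msimple_const)
  show "{t \<in> T. t \<in> Q} \<in> sets borel"
    using assms by (simp add: sets.Int flip: Int_def)
qed (rule assms(1))+

lemma msimple_floor:
  fixes \<psi> :: "'a::euclidean_space \<Rightarrow> real"
  assumes m: "\<psi> \<in> borel_measurable (restrict_space lborel T)" and T: "T \<in> sets borel"
    and C: "\<And>t. t \<in> T \<Longrightarrow> \<bar>\<psi> t\<bar> \<le> C"
  shows "msimple T (\<lambda>t. \<lfloor>\<psi> t\<rfloor>)"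
proof -
  have "(\<lambda>t. \<lfloor>\<psi> t\<rfloor>) ` T \<subseteq> {\<lfloor>- C\<rfloor>..\<lfloor>C\<rfloor>}"
    using C by (auto intro!: floor_mono simp: abs_le_iff minus_le_iff)
  then have "finite ((\<lambda>t. \<lfloor>\<psi> t\<rfloor>) ` T)"
    using finite_subset by blast
  moreover have "{t\<in>T. \<lfloor>\<psi> t\<rfloor> = v} \<in> sets borel" for v
  proof -
    have "\<psi> -` {of_int v..<of_int v + 1} \<inter> space (restrict_space lborel T) \<in> sets (restrict_space lborel T)"
      by (rule measurable_sets[OF m]) simp
    moreover have "\<psi> -` {of_int v..<of_int v + 1} \<inter> space (restrict_space lborel T) = {t\<in>T. \<lfloor>\<psi> t\<rfloor> = v}"
      by (auto simp: space_restrict_space floor_eq_iff)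
    ultimately show ?thesis
      using T by (simp add: sets_restrict_space_iff)
  qed
  ultimately show ?thesis
    by (simp add: msimple_def)
qed

section \<open>Arithmetic, metric and finite sums in the space\<close>

locale convexified_L_space =
  fixes X :: "('x, 'm) slspace_scheme" and P :: "'x \<Rightarrow> 'x"
  assumes LX: "L_space X" and PX: "convexifying X P"
begin

abbreviation add (infixl "\<oplus>" 65) where "x \<oplus> y \<equiv> sadd X x y"
abbreviation mul (infixr "\<odot>" 75) where "a \<odot> x \<equiv> smul X a x"
abbreviation zero ("\<theta>") where "\<theta> \<equiv> szero X"
abbreviation h where "h \<equiv> hX X"
abbreviation SI where "SI \<equiv> simple_integral X P"

lemma add_commute: "x \<oplus> y = y \<oplus> x"
  and add_assoc: "x \<oplus> (y \<oplus> z) = (x \<oplus> y) \<oplus> z"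
  and add_zero: "x \<oplus> \<theta> = x"
  and mul_add: "a \<odot> (x \<oplus> y) = a \<odot> x \<oplus> a \<odot> y"
  and mul_mul: "a \<odot> (b \<odot> x) = (a * b) \<odot> x"
  and mul_one: "1 \<odot> x = x"
  and mul_zero_left: "0 \<odot> x = \<theta>"
  using LX unfolding L_space_def semilinear_space_def by metis+

lemma mul_zero_right: "a \<odot> \<theta> = \<theta>"
  by (metis mul_mul mul_zero_left mult_zero_right)

lemma h_eq_0: "h x y = 0 \<longleftrightarrow> x = y"
  and h_sym: "h x y = h y x"
  and h_triangle: "h x z \<le> h x y + h y z"
  and h_mul: "h (a \<odot> x) (a \<odot> y) = \<bar>a\<bar> * h x y"
  and h_add_right: "h (x \<oplus> z) (y \<oplus> z) \<le> h x y"
  using LX unfolding L_space_def is_metric_def by blast+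

lemma h_refl [simp]: "h x x = 0"
  by (simp add: h_eq_0)

lemma h_nonneg: "0 \<le> h x y"
  using h_triangle[of x x y] h_sym[of x y] by simp

lemma h_diff_le: "\<bar>h x z - h y z\<bar> \<le> h x y"
  using h_triangle[of x z y] h_triangle[of y z x] h_sym[of x y] by linarith

lemma h_add: "h (x \<oplus> y) (x' \<oplus> y') \<le> h x x' + h y y'"
  using h_triangle[of "x \<oplus> y" "x' \<oplus> y'" "x' \<oplus> y"] h_add_right[of x y x'] h_add_right[of y x' y']
  by (simp add: add_commute)

lemma P_nonexpansive: "h (P x) (P y) \<le> h x y"
  using PX unfolding convexifying_def by blast

lemma P_zero: "P \<theta> = \<theta>"
proof -
  have "P (0 \<odot> \<theta> \<oplus> 0 \<odot> \<theta>) = 0 \<odot> P \<theta> \<oplus> 0 \<odot> P \<theta>"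
    using PX unfolding convexifying_def by blast
  then show ?thesis
    by (simp add: mul_zero_left add_zero)
qed

lemma P_convex: "convex_elt X x \<Longrightarrow> P x = x"
  using PX unfolding convexifying_def Xc_def by (metis mem_Collect_eq rangeE)

text \<open>Sums of scalars are guaranteed to distribute only over convex elements, and the range of
  \<open>P\<close> consists of these.\<close>

lemma P_mul_add: "0 \<le> a \<Longrightarrow> 0 \<le> b \<Longrightarrow> (a + b) \<odot> P x = a \<odot> P x \<oplus> b \<odot> P x"
proof -
  have "convex_elt X (P x)"
    using PX unfolding convexifying_def Xc_def by blast
  then show "0 \<le> a \<Longrightarrow> 0 \<le> b \<Longrightarrow> (a + b) \<odot> P x = a \<odot> P x \<oplus> b \<odot> P x"
    by (simp add: convex_elt_def)
qed

text \<open>The operations live in a record, not in a type class; this interpretation supplies the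
  laws of finite sums as \<open>S.F\<close>.\<close>

sublocale S: comm_monoid_set "sadd X" "szero X"
  by standard (metis add_assoc, rule add_commute, rule add_zero)

lemma ssum_eq: "ssum X g A = S.F g A"
  by (simp add: ssum_def S.eq_fold comp_def)

lemma P_mul_sum:
  assumes "finite A" "\<And>i. i \<in> A \<Longrightarrow> 0 \<le> m i"
  shows "(\<Sum>i\<in>A. m i) \<odot> P x = S.F (\<lambda>i. m i \<odot> P x) A"
  using assms by (induction A rule: finite_induct) (auto simp: mul_zero_left P_mul_add sum_nonneg)

lemma h_sum:
  assumes "finite A"
  shows "h (S.F f A) (S.F g A) \<le> (\<Sum>i\<in>A. h (f i) (g i))"
  using assms
proof (induction A rule: finite_induct)
  case (insert i A)
  then show ?case
    using h_add[of "f i" "S.F f A" "g i" "S.F g A"] by simp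
qed simp

text \<open>The definition groups \<open>T\<close> by the values of the composed function. The finer
  grouping by the values of \<open>p\<close> gives the same sum: measures add up, and sums of
  nonnegative scalars distribute over \<open>P v\<close>.\<close>

lemma simple_integral_comp:
  assumes p: "msimple T p" and T: "compact (T::'a::euclidean_space set)"
  shows "SI T (\<lambda>t. F (p t)) = S.F (\<lambda>w. measure lborel {t\<in>T. p t = w} \<odot> P (F w)) (p ` T)"
proof -
  let ?A = "p ` T" and ?m = "\<lambda>w. measure lborel {t\<in>T. p t = w}"
  note fin = msimple_finite[OF p]
  have m: "measure lborel {t\<in>T. F (p t) = v} = (\<Sum>w\<in>{w. w \<in> ?A \<and> F w = v}. ?m w)" for v
  proof -
    have "{t\<in>T. F (p t) = v} = (\<Union>w\<in>{w. w \<in> ?A \<and> F w = v}. {t\<in>T. p t = w})"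
      by auto
    then show ?thesis
      using fin msimple_sets[OF p] compact_subset_measure_finite[OF T, THEN less_imp_neq]
      by (auto intro!: measure_finite_Union simp: disjoint_family_on_def)
  qed
  have "SI T (\<lambda>t. F (p t)) = S.F (\<lambda>v. measure lborel {t\<in>T. F (p t) = v} \<odot> P v) (F ` ?A)"
    by (simp add: simple_integral_def ssum_eq image_image)
  also have "\<dots> = S.F (\<lambda>v. S.F (\<lambda>w. ?m w \<odot> P (F w)) {w. w \<in> ?A \<and> F w = v}) (F ` ?A)"
  proof (rule S.cong[OF refl])
    fix v
    have "measure lborel {t\<in>T. F (p t) = v} \<odot> P v = S.F (\<lambda>w. ?m w \<odot> P v) {w. w \<in> ?A \<and> F w = v}"
      unfolding m using fin by (intro P_mul_sum) auto
    also have "\<dots> = S.F (\<lambda>w. ?m w \<odot> P (F w)) {w. w \<in> ?A \<and> F w = v}"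
      by (rule S.cong) auto
    finally show "measure lborel {t\<in>T. F (p t) = v} \<odot> P v = \<dots>" .
  qed
  also have "\<dots> = S.F (\<lambda>w. ?m w \<odot> P (F w)) ?A"
    using fin by (intro S.group) auto
  finally show ?thesis .
qed

text \<open>Taking the pair as common partition turns both integrals into sums over the same index
  set, which are compared term by term; \<open>P\<close> does not increase distances.\<close>

lemma h_simple_integral:
  assumes f: "msimple T f" and g: "msimple T g" and T: "compact (T::'a::euclidean_space set)"
  shows "h (SI T f) (SI T g) \<le> (LINT t:T|lborel. h (f t) (g t))"
proof -
  let ?p = "\<lambda>t. (f t, g t)"
  let ?m = "\<lambda>w. measure lborel {t\<in>T. ?p t = w}"
  have p: "msimple T ?p"
    using f g by (rule msimple_Pair)
  have "h (SI T f) (SI T g) = h (S.F (\<lambda>w. ?m w \<odot> P (fst w)) (?p ` T)) (S.F (\<lambda>w. ?m w \<odot> P (snd w)) (?p ` T))"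
    using simple_integral_comp[OF p T, of fst] simple_integral_comp[OF p T, of snd] by simp
  also have "\<dots> \<le> (\<Sum>w\<in>?p ` T. h (?m w \<odot> P (fst w)) (?m w \<odot> P (snd w)))"
    by (rule h_sum[OF msimple_finite[OF p]])
  also have "\<dots> \<le> (\<Sum>w\<in>?p ` T. ?m w * h (fst w) (snd w))"
    by (rule sum_mono) (simp add: h_mul P_nonexpansive mult_left_mono)
  also have "\<dots> = (LINT t:T|lborel. h (f t) (g t))"
    using msimple_set_integral(2)[OF p T, of "\<lambda>w. h (fst w) (snd w)"] by simp
  finally show ?thesis .
qed

section \<open>Existence and estimates of the integral\<close>

lemma msimple_bounded:
  assumes "msimple T s"
  obtains C where "\<And>t. t \<in> T \<Longrightarrow> h (s t) \<theta> \<le> C"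
proof -
  have fin: "finite ((\<lambda>v. h v \<theta>) ` s ` T)"
    using assms by (simp add: msimple_finite)
  show ?thesis
    using Max_ge[OF fin] by (intro that[of "Max ((\<lambda>v. h v \<theta>) ` s ` T)"]) auto
qed

lemma msimple_iff:
  assumes T: "T \<in> sets borel"
  shows "s \<in> BTX X T \<and> simple_X T s \<longleftrightarrow> msimple T s"
proof safe
  assume s: "s \<in> BTX X T" "simple_X T s"
  have "{t\<in>T. s t = v} \<in> sets borel" for v
  proof -
    have "(\<lambda>t. h (s t) v) \<in> borel_measurable (restrict_space lborel T)"
      using s by (auto simp: BTX_def measurable_X_def)
    then have "(\<lambda>t. h (s t) v) -` {0} \<inter> space (restrict_space lborel T) \<in> sets (restrict_space lborel T)"
      by (rule measurable_sets) simp
    moreover have "(\<lambda>t. h (s t) v) -` {0} \<inter> space (restrict_space lborel T) = {t\<in>T. s t = v}"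
      by (auto simp: space_restrict_space h_eq_0)
    ultimately show ?thesis
      using T by (simp add: sets_restrict_space_iff)
  qed
  then show "msimple T s"
    using s by (simp add: msimple_def simple_X_def)
next
  assume s: "msimple T s"
  show "simple_X T s"
    using s by (simp add: simple_X_def msimple_def)
  have "measurable_X X T s"
    unfolding measurable_X_def
  proof
    fix x
    show "(\<lambda>t. h (s t) x) \<in> borel_measurable (restrict_space lborel T)"
      by (rule msimple_apply_measurable[OF s _ T, of "\<lambda>v t. h v x"]) simp
  qed
  moreover have "bounded_X X T s"
    unfolding bounded_X_def by (rule msimple_bounded[OF s]) blast
  ultimately show "s \<in> BTX X T"
    by (simp add: BTX_def)
qed

text \<open>The sequences over which the definition of \<open>integral_X\<close> quantifies, with
  the condition on each term put in the form of \<open>msimple\<close>.\<close>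

definition approximates :: "'a::euclidean_space set \<Rightarrow> (nat \<Rightarrow> 'a \<Rightarrow> 'x) \<Rightarrow> ('a \<Rightarrow> 'x) \<Rightarrow> bool" where
  "approximates T s f \<longleftrightarrow> (\<forall>k. msimple T (s k)) \<and> (\<exists>C. \<forall>k. \<forall>t\<in>T. h (s k t) \<theta> \<le> C) \<and>
     (AE t in lborel. t \<in> T \<longrightarrow> hconv X (\<lambda>k. s k t) (f t))"

lemma integral_X_eq_The:
  assumes "T \<in> sets borel"
  shows "integral_X X P T f = (THE I. \<forall>s. approximates T s f \<longrightarrow> hconv X (\<lambda>k. SI T (s k)) I)"
  unfolding integral_X_def approximates_def msimple_iff[OF assms] ..

lemma measurable_X_h_msimple:
  assumes f: "f \<in> BTX X T" and s: "msimple T s" and T: "T \<in> sets borel"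
  shows "(\<lambda>t. h (f t) (s t)) \<in> borel_measurable (restrict_space lborel T)"
  using f by (intro msimple_apply_measurable[OF s _ T, of "\<lambda>v t. h (f t) v"])
    (auto simp: BTX_def measurable_X_def)

lemma BTX_h_msimple_integrable:
  assumes f: "f \<in> BTX X T" and s: "msimple T s" and T: "compact T"
  shows "set_integrable lborel T (\<lambda>t. h (f t) (s t))"
proof -
  obtain C where C: "\<And>t. t \<in> T \<Longrightarrow> h (s t) \<theta> \<le> C"
    using msimple_bounded[OF s] by blast
  obtain C' where C': "\<And>t. t \<in> T \<Longrightarrow> h (f t) \<theta> \<le> C'"
    using f by (auto simp: BTX_def bounded_X_def)
  have "\<bar>h (f t) (s t)\<bar> \<le> C' + C" if "t \<in> T" for t
    using C[OF that] C'[OF that] h_triangle[of "f t" "s t" \<theta>] h_nonneg h_sym[of "s t" \<theta>] by simp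
  then show ?thesis
    using T f s by (intro set_integrable_bounded_compact measurable_X_h_msimple)
      (auto intro: compact_borel)
qed

text \<open>Dominated convergence: the bounds for the sequence and for \<open>f\<close> give a
  constant majorant on \<open>T\<close>, whose measure is finite.\<close>

lemma approximates_L1:
  assumes f: "f \<in> BTX X T" and s: "approximates T s f" and T: "compact T"
  shows "(\<lambda>k. LINT t:T|lborel. h (f t) (s k t)) \<longlonglongrightarrow> 0"
proof -
  have T': "T \<in> sets borel"
    using T by (rule compact_borel)
  obtain C where C: "\<And>k t. t \<in> T \<Longrightarrow> h (s k t) \<theta> \<le> C"
    using s by (auto simp: approximates_def)
  obtain C' where C': "\<And>t. t \<in> T \<Longrightarrow> h (f t) \<theta> \<le> C'"
    using f by (auto simp: BTX_def bounded_X_def)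
  have bd: "h (f t) (s k t) \<le> C' + C" if "t \<in> T" for t k
    using C[OF that, of k] C'[OF that] h_triangle[of "f t" "s k t" \<theta>] h_sym[of "s k t" \<theta>] by simp
  have "(\<lambda>k. LINT t|lborel. indicator T t *\<^sub>R h (f t) (s k t)) \<longlonglongrightarrow> (LINT t|lborel. indicator T t *\<^sub>R (0::real))"
  proof (rule integral_dominated_convergence[where w = "\<lambda>t. indicator T t *\<^sub>R (C' + C)"])
    show "integrable lborel (\<lambda>t. indicator T t *\<^sub>R (C' + C))"
      using compact_subset_measure_finite[OF T, of T] T'
      by (intro integrable_scaleR_left) (auto simp: integrable_indicator_iff)
    show "(\<lambda>t. indicator T t *\<^sub>R h (f t) (s k t)) \<in> borel_measurable lborel" for k
      using BTX_h_msimple_integrable[OF f _ T, of "s k"] s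
      by (auto simp: set_integrable_def approximates_def)
    show "AE t in lborel. (\<lambda>k. indicator T t *\<^sub>R h (f t) (s k t)) \<longlonglongrightarrow> indicator T t *\<^sub>R 0"
    proof -
      have "AE t in lborel. t \<in> T \<longrightarrow> hconv X (\<lambda>k. s k t) (f t)"
        using s by (simp add: approximates_def)
      then show ?thesis
        by eventually_elim (auto simp: hconv_def indicator_def h_sym)
    qed
    show "AE t in lborel. norm (indicator T t *\<^sub>R h (f t) (s k t)) \<le> indicator T t *\<^sub>R (C' + C)" for k
      using bd by (auto simp: indicator_def h_nonneg)
  qed simp
  then show ?thesis
    by (simp add: set_lebesgue_integral_def)
qed

text \<open>The triangle inequality through \<open>f\<close> under the integral sign. With the
  preceding convergence it makes the integrals of an approximating sequence Cauchy and lets two such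
  sequences be compared.\<close>

lemma h_simple_integral_via:
  assumes f: "f \<in> BTX X T" and s: "msimple T s" and s': "msimple T s'" and T: "compact T"
  shows "h (SI T s) (SI T s') \<le> (LINT t:T|lborel. h (f t) (s t)) + (LINT t:T|lborel. h (f t) (s' t))"
proof -
  have "h (SI T s) (SI T s') \<le> (LINT t:T|lborel. h (s t) (s' t))"
    using s s' T by (rule h_simple_integral)
  also have "\<dots> \<le> (LINT t:T|lborel. h (f t) (s t) + h (f t) (s' t))"
    using msimple_set_integral(1)[OF msimple_Pair[OF s s'] T, of "\<lambda>(a, b). h a b"]
      BTX_h_msimple_integrable[OF f s T] BTX_h_msimple_integrable[OF f s' T]
    by (intro set_integral_mono set_integral_add(1)) (auto simp: h_triangle h_sym[of "f _" "s _"])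
  also have "\<dots> = (LINT t:T|lborel. h (f t) (s t)) + (LINT t:T|lborel. h (f t) (s' t))"
    by (intro set_integral_add(2) BTX_h_msimple_integrable f s s' T)
  finally show ?thesis .
qed

text \<open>Separability supplies a dense sequence; a greedy choice among its first terms converges
  at every point, more than the almost everywhere convergence required.\<close>

lemma approximates_exists:
  assumes f: "f \<in> BTX X T" and T: "compact T"
  obtains s where "approximates T s f"
proof -
  have T': "T \<in> sets borel"
    using T by (rule compact_borel)
  obtain D where D: "countable D" "\<And>x e. e > 0 \<Longrightarrow> \<exists>d\<in>D. h x d < e"
    using LX unfolding L_space_def separable_h_def by metis
  have "D \<noteq> {}"
    using D(2)[of 1] by auto
  then obtain d :: "nat \<Rightarrow> 'x" where d: "range d = D"
    using D(1) uncountable_def by blast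
  \<comment> \<open>\<open>s k t\<close> is a point nearest to \<open>f t\<close> among \<open>\<theta>, d 0, \<dots>, d (k - 1)\<close>; including \<open>\<theta>\<close> makes the
    sequence uniformly bounded.\<close>
  define s where "s = rec_nat (\<lambda>t. \<theta>) (\<lambda>k u t. if h (f t) (d k) < h (f t) (u t) then d k else u t)"
  have s0: "s 0 t = \<theta>" and sS: "s (Suc k) t = (if h (f t) (d k) < h (f t) (s k t) then d k else s k t)" for k t
    by (simp_all add: s_def)
  have ms: "msimple T (s k)" for k
  proof (induction k)
    case 0
    show ?case
      using msimple_const[OF T'] by (simp add: s_def)
  next
    case (Suc k)
    have "{t\<in>T. h (f t) (d k) < h (f t) (s k t)} \<in> sets borel"
    proof -
      have [measurable]: "(\<lambda>t. h (f t) (s k t)) \<in> borel_measurable (restrict_space lborel T)"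
        by (rule measurable_X_h_msimple[OF f Suc T'])
      have [measurable]: "(\<lambda>t. h (f t) (d k)) \<in> borel_measurable (restrict_space lborel T)"
        using f by (simp add: BTX_def measurable_X_def)
      have "{t\<in>space (restrict_space lborel T). h (f t) (d k) < h (f t) (s k t)}
          \<in> sets (restrict_space lborel T)"
        by measurable
      then show ?thesis
        using T' by (simp add: sets_restrict_space_iff space_restrict_space)
    qed
    then have "msimple T (\<lambda>t. if h (f t) (d k) < h (f t) (s k t) then d k else s k t)"
      by (intro msimple_If msimple_const[OF T'] Suc)
    then show ?case
      using sS[of k] by presburger
  qed
  have dec: "h (f t) (s m t) \<le> h (f t) (s k t)" if "k \<le> m" for k m t
    using that by (induction m rule: dec_induct) (auto simp: sS)
  have near: "h (f t) (s m t) \<le> h (f t) (d k)" if "k < m" for k m t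
    using dec[of "Suc k" m t] that sS[of k t] by (auto split: if_splits)
  obtain C where C: "\<And>t. t \<in> T \<Longrightarrow> h (f t) \<theta> \<le> C"
    using f by (auto simp: BTX_def bounded_X_def)
  have "approximates T s f"
    unfolding approximates_def
  proof (intro conjI allI exI[of _ "2 * C"] ballI AE_I2 impI)
    fix k t assume "t \<in> T"
    have "h (s k t) \<theta> \<le> h (f t) (s k t) + h (f t) \<theta>"
      using h_triangle[of "s k t" \<theta> "f t"] by (simp add: h_sym)
    \<comment> \<open>\<open>s k t\<close> is at least as near to \<open>f t\<close> as the starting
      value \<theta>.\<close>
    also have "\<dots> \<le> 2 * C"
      using C[OF \<open>t \<in> T\<close>] dec[of 0 k t] s0[of t] by simp
    finally show "h (s k t) \<theta> \<le> 2 * C" .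
  next
    fix t
    show "hconv X (\<lambda>k. s k t) (f t)"
      unfolding hconv_def
    proof (rule LIMSEQ_I)
      fix e :: real assume "e > 0"
      then obtain k where k: "h (f t) (d k) < e"
        using D(2)[of e "f t"] d by auto
      have "norm (h (s m t) (f t) - 0) < e" if "m \<ge> Suc k" for m
        using near[of k m t] that k h_nonneg[of "s m t" "f t"] by (simp add: h_sym)
      then show "\<exists>N. \<forall>m\<ge>N. norm (h (s m t) (f t) - 0) < e"
        by blast
    qed
  qed (rule ms)
  then show ?thesis
    by (rule that)
qed

text \<open>Completeness gives a limit along \<open>s\<close>, every other admissible sequence
  shares it, and uniqueness of limits leaves no second candidate for the definite description in
  \<open>integral_X\<close>.\<close>

lemma integral_X_limit:
  assumes f: "f \<in> BTX X T" and T: "compact T" and s: "approximates T s f"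
  shows "(\<lambda>k. h (SI T (s k)) (integral_X X P T f)) \<longlonglongrightarrow> 0"
proof -
  have T': "T \<in> sets borel"
    using T by (rule compact_borel)
  let ?D = "\<lambda>u k. LINT t:T|lborel. h (f t) (u k t)"
  have ms: "msimple T (s k)" for k
    using s by (simp add: approximates_def)
  have "\<exists>l. (\<lambda>k. h (SI T (s k)) l) \<longlonglongrightarrow> 0"
  proof -
    have "\<exists>N. \<forall>m\<ge>N. \<forall>k\<ge>N. h (SI T (s m)) (SI T (s k)) < e" if e: "e > 0" for e
    proof -
      obtain N where N: "\<And>k. k \<ge> N \<Longrightarrow> ?D s k < e / 2"
        using order_tendstoD(2)[OF approximates_L1[OF f s T] half_gt_zero[OF e]]
        unfolding eventually_sequentially by blast
      have "h (SI T (s m)) (SI T (s k)) < e" if "m \<ge> N" "k \<ge> N" for m k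
        using h_simple_integral_via[OF f ms[of m] ms[of k] T] N[of m] N[of k] that by linarith
      then show ?thesis
        by blast
    qed
    moreover have "complete_h h"
      using LX unfolding L_space_def by blast
    ultimately show ?thesis
      unfolding complete_h_def by (elim allE[of _ "\<lambda>k. SI T (s k)"]) simp
  qed
  then obtain l where l: "(\<lambda>k. h (SI T (s k)) l) \<longlonglongrightarrow> 0"
    by blast
  have lim: "hconv X (\<lambda>k. SI T (u k)) l" if u: "approximates T u f" for u
    unfolding hconv_def
  proof (rule real_tendsto_sandwich[of "\<lambda>_. 0"])
    have mu: "msimple T (u k)" for k
      using u by (simp add: approximates_def)
    have "h (SI T (u k)) l \<le> (?D u k + ?D s k) + h (SI T (s k)) l" for k
      using h_triangle[of "SI T (u k)" l "SI T (s k)"] h_simple_integral_via[OF f mu[of k] ms[of k] T]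
      by linarith
    then show "\<forall>\<^sub>F k in sequentially. h (SI T (u k)) l \<le> (?D u k + ?D s k) + h (SI T (s k)) l"
      by simp
    show "(\<lambda>k. (?D u k + ?D s k) + h (SI T (s k)) l) \<longlonglongrightarrow> 0"
      using tendsto_add[OF tendsto_add[OF approximates_L1[OF f u T] approximates_L1[OF f s T]] l] by simp
  qed (auto simp: h_nonneg)
  have "integral_X X P T f = l"
    unfolding integral_X_eq_The[OF T']
  proof (rule the_equality)
    \<comment> \<open>The given sequence \<open>s\<close> is what keeps the universal condition on
      \<open>I\<close> from being vacuous.\<close>
    fix I assume I: "\<forall>s. approximates T s f \<longrightarrow> hconv X (\<lambda>k. SI T (s k)) I"
    have "(\<lambda>k. h (SI T (s k)) I + h (SI T (s k)) l) \<longlonglongrightarrow> 0 + 0"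
      using I s l by (intro tendsto_add) (auto simp: hconv_def)
    moreover have "h I l \<le> h (SI T (s k)) I + h (SI T (s k)) l" for k
      using h_triangle[of I l "SI T (s k)"] h_sym[of I "SI T (s k)"] by simp
    ultimately have "h I l \<le> 0 + 0"
      using LIMSEQ_le_const by blast
    then show "I = l"
      using h_nonneg[of I l] h_eq_0 by force
  qed (use lim in auto)
  then show ?thesis
    using l by simp
qed

text \<open>Passage to the limit in the estimate for simple functions. The second argument stays
  simple, enough for comparison with a constant on a ball and with a quantised function.\<close>

lemma h_integral_X_simple:
  assumes f: "f \<in> BTX X T" and g: "msimple T g" and T: "compact T"
  shows "h (integral_X X P T f) (SI T g) \<le> (LINT t:T|lborel. h (f t) (g t))"
proof -
  obtain s where s: "approximates T s f"
    using approximates_exists[OF f T] by blast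
  let ?D = "\<lambda>k. LINT t:T|lborel. h (f t) (s k t)"
  have ms: "msimple T (s k)" for k
    using s by (simp add: approximates_def)
  have "(\<lambda>k. h (SI T (s k)) (integral_X X P T f) + (?D k + (LINT t:T|lborel. h (f t) (g t))))
      \<longlonglongrightarrow> 0 + (0 + (LINT t:T|lborel. h (f t) (g t)))"
    by (intro tendsto_add tendsto_const integral_X_limit approximates_L1 f s T)
  moreover have "h (integral_X X P T f) (SI T g)
      \<le> h (SI T (s k)) (integral_X X P T f) + (?D k + (LINT t:T|lborel. h (f t) (g t)))" for k
    using h_triangle[of "integral_X X P T f" "SI T g" "SI T (s k)"]
      h_simple_integral_via[OF f ms[of k] g T] h_sym[of "SI T (s k)"] by simp
  ultimately have "h (integral_X X P T f) (SI T g) \<le> 0 + (0 + (LINT t:T|lborel. h (f t) (g t)))"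
    using LIMSEQ_le_const by blast
  then show ?thesis
    by simp
qed

end

section \<open>The upper bound\<close>

lemma Ttilde_closed:
  fixes T :: "'a::euclidean_space set"
  assumes "closed T"
  shows "closed (Ttilde T n xs i)"
proof -
  have "Ttilde T n xs i = T \<inter> (\<Inter>j\<in>{j. j < n \<and> j \<noteq> i}. {t. dist t (xs i) \<le> dist t (xs j)})"
    by (auto simp: Ttilde_def)
  moreover have "closed {t. dist t (xs i) \<le> dist t (xs j)}" for j
    by (intro closed_Collect_le continuous_intros)
  ultimately show ?thesis
    using assms by (auto intro!: closed_Int closed_INT)
qed

lemma Tpart_borel:
  fixes T :: "'a::euclidean_space set"
  assumes "closed T"
  shows "Tpart T n xs i \<in> sets borel"
  using Ttilde_closed[OF assms] unfolding Tpart_def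
  by (intro sets.Diff sets.finite_UN) (auto intro: borel_closed)

text \<open>\<open>i\<close> is the least index at which the distance is minimal: removing the
  earlier sets from each \<open>Ttilde\<close> breaks ties in favour of the smaller index.\<close>

lemma Tpart_nearest:
  assumes "t \<in> T" "1 \<le> (n::nat)"
  obtains i where "i < n" "\<And>j. j < n \<Longrightarrow> dist t (xs i) \<le> dist t (xs j)"
    "\<And>j. j < n \<Longrightarrow> t \<in> Tpart T n xs j \<longleftrightarrow> j = i"
proof -
  have "\<exists>i\<in>{..<n}. \<forall>j\<in>{..<n}. dist t (xs i) \<le> dist t (xs j)"
  proof -
    let ?d = "(\<lambda>i. dist t (xs i)) ` {..<n}"
    have "Min ?d \<in> ?d"
      using assms(2) by (intro Min_in) (auto simp: lessThan_empty_iff)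
    then obtain i where "i < n" "Min ?d = dist t (xs i)"
      by auto
    moreover have "Min ?d \<le> dist t (xs j)" if "j < n" for j
      using that by (intro Min_le) auto
    ultimately show ?thesis
      by auto
  qed
  then have ex: "\<exists>i. i < n \<and> t \<in> Ttilde T n xs i"
    using assms(1) by (auto simp: Ttilde_def)
  define i where "i = (LEAST i. i < n \<and> t \<in> Ttilde T n xs i)"
  have i: "i < n" "t \<in> Ttilde T n xs i"
    using LeastI_ex[OF ex] by (auto simp: i_def)
  have least: "i \<le> j" if "j < n" "t \<in> Ttilde T n xs j" for j
    unfolding i_def by (rule Least_le) (use that in simp)
  show ?thesis
  proof (rule that[OF i(1)])
    show "dist t (xs i) \<le> dist t (xs j)" if "j < n" for j
      using i(2) that by (cases "j = i") (auto simp: Ttilde_def)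
    show "t \<in> Tpart T n xs j \<longleftrightarrow> j = i" if "j < n" for j
    proof
      assume "t \<in> Tpart T n xs j"
      then have "t \<in> Ttilde T n xs j" "\<not> i < j"
        using i(2) by (auto simp: Tpart_def)
      then show "j = i"
        using least[OF that] by simp
    next
      assume "j = i"
      moreover have "t \<notin> Ttilde T n xs k" if "k < i" for k
        using least[of k] that i(1) by auto
      ultimately show "t \<in> Tpart T n xs j"
        using i(2) by (auto simp: Tpart_def)
    qed
  qed
qed

section \<open>Ball averages and the nearest-centre method\<close>

context convexified_L_space
begin

lemma h_continuous_H_omega:
  assumes om: "modulus_of_continuity \<omega>" and f: "f \<in> H_omega X \<omega> T"
  shows "continuous_on T (\<lambda>t. h (f t) x)"
proof (rule continuous_on_modulus[OF om])
  fix s t assume "s \<in> T" "t \<in> T"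
  then have "h (f s) (f t) \<le> \<omega> (dist s t)"
    using f by (simp add: H_omega_def)
  then show "\<bar>h (f s) x - h (f t) x\<bar> \<le> \<omega> (dist s t)"
    using h_diff_le[of "f s" x "f t"] by linarith
qed

lemma H_omega_BTX:
  assumes om: "modulus_of_continuity \<omega>" and f: "f \<in> H_omega X \<omega> T" and T: "compact T"
  shows "f \<in> BTX X T"
proof -
  note cont = h_continuous_H_omega[OF om f]
  have "bounded ((\<lambda>t. h (f t) \<theta>) ` T)"
    by (intro compact_imp_bounded compact_continuous_image cont T)
  then have "bounded_X X T f"
    unfolding bounded_X_def bounded_iff by (fastforce simp: abs_le_iff)
  moreover have "measurable_X X T f"
    unfolding measurable_X_def using cont borel_measurable_restrict_lborel by blast
  ultimately show ?thesis
    by (simp add: BTX_def)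
qed

lemma BTX_restrict:
  assumes f: "f \<in> BTX X T" and Q: "Q \<in> sets borel"
  shows "(\<lambda>t. if t \<in> Q then f t else \<theta>) \<in> BTX X T"
proof -
  have "bounded_X X T (\<lambda>t. if t \<in> Q then f t else \<theta>)"
  proof -
    obtain C where "\<forall>t\<in>T. h (f t) \<theta> \<le> C"
      using f by (auto simp: BTX_def bounded_X_def)
    then show ?thesis
      unfolding bounded_X_def by (intro exI[of _ "max C 0"]) auto
  qed
  moreover have "measurable_X X T (\<lambda>t. if t \<in> Q then f t else \<theta>)"
    unfolding measurable_X_def
  proof
    fix x
    have m: "(\<lambda>t. h (f t) x) \<in> borel_measurable (restrict_space lborel T)"
      using f by (simp add: BTX_def measurable_X_def)
    have "Q \<inter> space (restrict_space lborel T) \<in> sets (restrict_space lborel T)"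
      using Q by (auto simp: sets_restrict_space space_restrict_space)
    then have "(\<lambda>t. if t \<in> Q then h (f t) x else h \<theta> x) \<in> borel_measurable (restrict_space lborel T)"
      by (intro measurable_If_set m) (auto simp: Int_commute)
    moreover have "(\<lambda>t. h (if t \<in> Q then f t else \<theta>) x) = (\<lambda>t. if t \<in> Q then h (f t) x else h \<theta> x)"
      by auto
    ultimately show "(\<lambda>t. h (if t \<in> Q then f t else \<theta>) x) \<in> borel_measurable (restrict_space lborel T)"
      by simp
  qed
  ultimately show ?thesis
    by (simp add: BTX_def)
qed

lemma simple_integral_indicator:
  assumes Q: "Q \<in> sets borel" "Q \<subseteq> T" and T: "compact T"
  shows "SI T (\<lambda>t. if t \<in> Q then x else \<theta>) = measure lborel Q \<odot> P x"
proof -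
  let ?p = "\<lambda>t. t \<in> Q"
  let ?F = "\<lambda>b. if b then x else \<theta>"
  have "msimple T (\<lambda>t. if t \<in> Q then True else False)"
    by (rule msimple_indicator[OF compact_borel[OF T] Q(1)])
  moreover have "(\<lambda>t. if t \<in> Q then True else False) = ?p"
    by auto
  ultimately have p: "msimple T ?p"
    by simp
  have "SI T (\<lambda>t. ?F (?p t)) = S.F (\<lambda>b. measure lborel {t\<in>T. ?p t = b} \<odot> P (?F b)) (?p ` T)"
    by (rule simple_integral_comp[OF p T, of ?F])
  \<comment> \<open>One truth value may not occur, as for empty \<open>Q\<close> or
    \<open>Q = T\<close>; its level set is then empty and contributes the neutral element.\<close>
  also have "\<dots> = S.F (\<lambda>b. measure lborel {t\<in>T. ?p t = b} \<odot> P (?F b)) {True, False}"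
  proof (rule S.mono_neutral_left)
    show "\<forall>b\<in>{True, False} - ?p ` T. measure lborel {t\<in>T. ?p t = b} \<odot> P (?F b) = \<theta>"
    proof
      fix b assume "b \<in> {True, False} - ?p ` T"
      then have "{t\<in>T. ?p t = b} = {}"
        by auto
      then show "measure lborel {t\<in>T. ?p t = b} \<odot> P (?F b) = \<theta>"
        by (simp only: measure_empty mul_zero_left)
    qed
  qed auto
  also have "\<dots> = measure lborel {t\<in>T. t \<in> Q} \<odot> P x"
    by (simp add: P_zero mul_zero_right add_zero)
  also have "{t\<in>T. t \<in> Q} = Q"
    using Q(2) by auto
  finally show ?thesis .
qed

text \<open>The function equal to \<open>x\<close> on \<open>Q\<close> and to \<theta> elsewhere has
  integral \<open>measure lborel Q \<odot> P x\<close>, so the contraction estimate compares it with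
  the restriction of \<open>f\<close>.\<close>

lemma h_integral_on_const:
  assumes om: "modulus_of_continuity \<omega>" and f: "f \<in> H_omega X \<omega> T" and T: "compact T"
    and Q: "compact Q" "Q \<subseteq> T"
  shows "h (integral_on X P T Q f) (measure lborel Q \<odot> P x) \<le> integral Q (\<lambda>s. h (f s) x)"
proof -
  note Qb = compact_borel[OF Q(1)]
  have "h (integral_on X P T Q f) (measure lborel Q \<odot> P x)
      \<le> (LINT t:T|lborel. h (if t \<in> Q then f t else \<theta>) (if t \<in> Q then x else \<theta>))"
    unfolding integral_on_def simple_integral_indicator[OF Qb Q(2) T, of x, symmetric]
    by (intro h_integral_X_simple BTX_restrict H_omega_BTX[OF om f T] Qb T
        msimple_indicator[OF compact_borel[OF T] Qb])
  also have "\<dots> = (LINT t:Q|lborel. h (f t) x)"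
    unfolding set_lebesgue_integral_def
    by (rule Bochner_Integration.integral_cong) (use Q(2) in \<open>auto simp: indicator_def\<close>)
  also have "\<dots> = integral Q (\<lambda>s. h (f s) x)"
  proof (rule set_borel_integral_eq_integral(2))
    show "set_integrable lborel Q (\<lambda>s. h (f s) x)"
      unfolding set_integrable_def
      by (intro borel_integrable_compact Q continuous_on_subset[OF h_continuous_H_omega[OF om f] Q(2)])
  qed
  finally show ?thesis .
qed

lemma h_info:
  assumes om: "modulus_of_continuity \<omega>" and f: "f \<in> H_omega X \<omega> T" and T: "compact T"
    and t: "t \<in> T" and i: "i < n" and e: "0 < e" and B: "cball (xs i) e \<subseteq> T"
  shows "h (P (f t)) (info X P T n xs e f i)
    \<le> 1 / measure lborel (cball (xs i) e) * integral (cball (xs i) e) (\<lambda>s. \<omega> (dist t s))"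
proof -
  let ?B = "cball (xs i) e"
  let ?\<mu> = "measure lborel ?B"
  have pos: "0 < ?\<mu>"
    by (rule content_cball_pos[OF e])
  \<comment> \<open>Exhibits \<open>P (f t)\<close> as the average of the constant
    \<open>f t\<close> over the ball, whose volume is positive because the radius is.\<close>
  have "P (f t) = (1 / ?\<mu>) \<odot> (?\<mu> \<odot> P (f t))"
    using pos by (simp add: mul_mul mul_one)
  then have "h (P (f t)) (info X P T n xs e f i)
      = h ((1 / ?\<mu>) \<odot> (?\<mu> \<odot> P (f t))) ((1 / ?\<mu>) \<odot> integral_on X P T ?B f)"
    using i by (simp add: info_def)
  also have "\<dots> = 1 / ?\<mu> * h (integral_on X P T ?B f) (?\<mu> \<odot> P (f t))"
    using pos unfolding h_mul by (simp add: h_sym)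
  also have "\<dots> \<le> 1 / ?\<mu> * integral ?B (\<lambda>s. h (f s) (f t))"
    using pos by (intro mult_left_mono h_integral_on_const[OF om f T compact_cball B]) auto
  also have "\<dots> \<le> 1 / ?\<mu> * integral ?B (\<lambda>s. \<omega> (dist t s))"
  proof (intro mult_left_mono integral_le)
    show "(\<lambda>s. h (f s) (f t)) integrable_on ?B"
      by (intro continuous_integrable_on_cball continuous_on_subset[OF h_continuous_H_omega[OF om f] B])
    show "(\<lambda>s. \<omega> (dist t s)) integrable_on ?B"
      by (intro continuous_integrable_on_cball modulus_dist_continuous[OF om])
    show "h (f s) (f t) \<le> \<omega> (dist t s)" if "s \<in> ?B" for s
      using f t B that by (auto simp: H_omega_def dist_commute)
  qed (use pos in simp)
  finally show ?thesis .
qed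

lemma Phi_star_methods:
  fixes T :: "'a::euclidean_space set"
  assumes T: "compact T"
  shows "Phi_star X T n xs \<in> methods X T"
proof -
  have Tb: "T \<in> sets borel"
    by (rule compact_borel[OF T])
  have "msimple T (Phi_star X T n xs y)" for y
  proof -
    \<comment> \<open>Only the number of summands varies in the induction; the sets
      \<open>Tpart\<close> keep their parameter \<open>n\<close>.\<close>
    have "msimple T (\<lambda>t. S.F (\<lambda>i. if t \<in> Tpart T n xs i then y i else \<theta>) {..<m})" for m
    proof (induction m)
      case 0
      show ?case
        using msimple_const[OF Tb] by simp
    next
      case (Suc m)
      have "msimple T (\<lambda>t. if t \<in> Tpart T n xs m then y m else \<theta>)"
        by (intro msimple_indicator Tb Tpart_borel compact_imp_closed T)
      from msimple_comp[OF msimple_Pair[OF this Suc], of "\<lambda>(a, b). a \<oplus> b"]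
      show ?case
        by (simp add: lessThan_Suc)
    qed
    then show ?thesis
      by (simp add: Phi_star_def[abs_def] ssum_eq)
  qed
  then show ?thesis
    using msimple_iff[OF Tb] by (auto simp: methods_def)
qed

lemma Phi_star_nearest:
  assumes "t \<in> T" "1 \<le> n"
  obtains i where "i < n" "\<And>j. j < n \<Longrightarrow> dist t (xs i) \<le> dist t (xs j)"
    "\<And>y. Phi_star X T n xs y t = y i"
proof -
  obtain i where i: "i < n" "\<And>j. j < n \<Longrightarrow> dist t (xs i) \<le> dist t (xs j)"
    "\<And>j. j < n \<Longrightarrow> t \<in> Tpart T n xs j \<longleftrightarrow> j = i"
    using Tpart_nearest[OF assms] by blast
  have "Phi_star X T n xs y t = y i" for y
  proof -
    have "Phi_star X T n xs y t = S.F (\<lambda>j. if j = i then y j else \<theta>) {..<n}"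
      unfolding Phi_star_def ssum_eq by (rule S.cong) (use i(3) in auto)
    also have "\<dots> = y i"
      using i(1) by (simp add: S.delta)
    finally show ?thesis .
  qed
  then show ?thesis
    using that[OF i(1,2)] by blast
qed

lemma Phi_star_error:
  fixes T :: "'a::euclidean_space set"
  assumes om: "modulus_of_continuity \<omega>" and T: "compact T" and n: "1 \<le> n"
    and e: "0 < e" and B: "\<forall>i<n. cball (xs i) e \<subseteq> T"
  shows "method_error X P \<omega> T (info X P T n xs e) (Phi_star X T n xs) \<le> bound_rhs \<omega> T n xs e"
  unfolding method_error_def hB_def
proof (intro SUP_least)
  fix f t assume f: "f \<in> H_omega X \<omega> T" and t: "t \<in> T"
  let ?a = "\<lambda>i. 1 / measure lborel (cball (xs i) e) * integral (cball (xs i) e) (\<lambda>s. \<omega> (dist t s))"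
  obtain i where i: "i < n" "\<And>j. j < n \<Longrightarrow> dist t (xs i) \<le> dist t (xs j)"
    "\<And>y. Phi_star X T n xs y t = y i"
    using Phi_star_nearest[OF t n] by blast
  \<comment> \<open>Balls of equal radius have equal volume, so the monotonicity of the integrals
    carries over to the means: the nearest centre attains the minimum in
    \<open>bound_rhs\<close>.\<close>
  have "?a i \<le> ?a j" if "j < n" for j
  proof -
    have "measure lborel (cball (xs i) e) = measure lborel (cball (xs j) e)"
      using e by (simp add: content_cball)
    moreover have "integral (cball (xs i) e) (\<lambda>s. \<omega> (dist t s)) \<le> integral (cball (xs j) e) (\<lambda>s. \<omega> (dist t s))"
      using om i(2)[OF that] by (intro integral_cball_dist_mono) (auto simp: modulus_of_continuity_def)
    ultimately show ?thesis
      by (metis divide_nonneg_nonneg measure_nonneg mult_left_mono zero_le_one)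
  qed
  then have "?a i \<le> Min (?a ` {..<n})"
    using n by (subst Min_ge_iff) (auto simp: lessThan_empty_iff)
  moreover have "h (P (f t)) (info X P T n xs e f i) \<le> ?a i"
    using i(1) B by (intro h_info om f T t e) auto
  ultimately have "ereal (h ((P \<circ> f) t) (Phi_star X T n xs (info X P T n xs e f) t)) \<le> ereal (Min (?a ` {..<n}))"
    by (simp add: i(3))
  also have "\<dots> \<le> bound_rhs \<omega> T n xs e"
    unfolding bound_rhs_def by (rule SUP_upper[OF t])
  finally show "ereal (h ((P \<circ> f) t) (Phi_star X T n xs (info X P T n xs e f) t)) \<le> bound_rhs \<omega> T n xs e" .
qed

end

section \<open>The lower bound\<close>

lemma finite_points_separated:
  fixes xs :: "nat \<Rightarrow> 'a::metric_space"
  obtains \<delta> where "0 < \<delta>" "\<And>i j. i < n \<Longrightarrow> j < n \<Longrightarrow> xs i \<noteq> xs j \<Longrightarrow> \<delta> \<le> dist (xs i) (xs j)"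
proof -
  \<comment> \<open>The inserted 1 keeps the set nonempty when no two of the points differ.\<close>
  let ?D = "insert 1 ((\<lambda>(i, j). dist (xs i) (xs j)) ` {(i, j). i < n \<and> j < n \<and> xs i \<noteq> xs j})"
  have "{(i, j). i < n \<and> j < n \<and> xs i \<noteq> xs j} \<subseteq> {..<n} \<times> {..<n}"
    by auto
  then have fin: "finite ?D"
    using finite_subset by blast
  show ?thesis
  proof (rule that[of "Min ?D"])
    show "0 < Min ?D"
      using fin by (subst Min_gr_iff) auto
    show "Min ?D \<le> dist (xs i) (xs j)" if "i < n" "j < n" "xs i \<noteq> xs j" for i j
      using that by (intro Min_le[OF fin]) auto
  qed
qed

text \<open>A direction for embedding the real line: \<open>x\<close> is convex and has the additive
  inverse \<open>x'\<close>, and the normalisation \<open>hX X x (szero X) = 1\<close> makes the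
  embedding an isometry.\<close>

locale isotropic_line = convexified_L_space X P
  for X :: "('x, 'm) slspace_scheme" and P :: "'x \<Rightarrow> 'x" +
  fixes x x' :: 'x
  assumes iso: "isotropic X" and x_convex: "convex_elt X x" and x_inv: "sadd X x x' = szero X"
    and x_unit: "hX X x (szero X) = 1"
begin

section \<open>An isometric copy of the real line\<close>

lemma h_add_cancel: "h (a \<oplus> c) (b \<oplus> c) = h a b"
  using iso by (simp add: isotropic_def)

lemma x_mul_add: "0 \<le> a \<Longrightarrow> 0 \<le> b \<Longrightarrow> (a + b) \<odot> x = a \<odot> x \<oplus> b \<odot> x"
  using x_convex by (simp add: convex_elt_def)

lemma mul_x_inv: "a \<odot> x \<oplus> a \<odot> x' = \<theta>"
  by (metis mul_add mul_zero_right x_inv)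

lemma inverse_unique: "y \<oplus> z = \<theta> \<Longrightarrow> y \<oplus> z' = \<theta> \<Longrightarrow> z = z'"
  by (metis add_assoc add_commute add_zero)

lemma add_swap: "(a \<oplus> b) \<oplus> (c \<oplus> d) = (a \<oplus> c) \<oplus> (b \<oplus> d)"
  by (metis add_assoc add_commute)

text \<open>Both sides are additive inverses of \<open>(a + b) \<odot> x\<close>, and inverses are
  unique.\<close>

lemma x'_mul_add:
  assumes "0 \<le> a" "0 \<le> b"
  shows "(a + b) \<odot> x' = a \<odot> x' \<oplus> b \<odot> x'"
proof (rule inverse_unique)
  show "(a + b) \<odot> x \<oplus> (a + b) \<odot> x' = \<theta>"
    by (rule mul_x_inv)
  show "(a + b) \<odot> x \<oplus> (a \<odot> x' \<oplus> b \<odot> x') = \<theta>"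
    unfolding x_mul_add[OF assms] add_swap by (simp add: mul_x_inv add_zero)
qed

text \<open>Since \<open>smul X (-1) x\<close> need not be the inverse of \<open>x\<close>, negative reals are represented by
  multiples of \<open>x'\<close>.\<close>

definition emb :: "real \<Rightarrow> 'x" where
  "emb r = max r 0 \<odot> x \<oplus> max (- r) 0 \<odot> x'"

text \<open>Every representation of a real as a difference of nonnegative numbers gives the same
  element: the common part \<open>c\<close> cancels against its inverse. This frees the laws below
  from case distinctions on signs.\<close>

lemma emb_diff:
  assumes "0 \<le> a" "0 \<le> b"
  shows "emb (a - b) = a \<odot> x \<oplus> b \<odot> x'"
proof -
  define c where "c = min a b"
  have ab: "a = max (a - b) 0 + c" "b = max (- (a - b)) 0 + c" "0 \<le> c"
    using assms by (auto simp: c_def)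
  have "a \<odot> x \<oplus> b \<odot> x' = (max (a - b) 0 + c) \<odot> x \<oplus> (max (- (a - b)) 0 + c) \<odot> x'"
    using ab(1,2) by simp
  also have "\<dots> = emb (a - b) \<oplus> (c \<odot> x \<oplus> c \<odot> x')"
    using ab(3) by (simp add: x_mul_add x'_mul_add add_swap emb_def)
  finally show ?thesis
    by (simp add: mul_x_inv add_zero)
qed

lemma emb_0: "emb 0 = \<theta>"
  by (simp add: emb_def mul_zero_left add_zero)

lemma emb_add: "emb (a + b) = emb a \<oplus> emb b"
proof -
  have "emb (a + b) = emb ((max a 0 + max b 0) - (max (- a) 0 + max (- b) 0))"
    by (rule arg_cong[of _ _ emb]) (simp add: max_def)
  also have "\<dots> = (max a 0 + max b 0) \<odot> x \<oplus> (max (- a) 0 + max (- b) 0) \<odot> x'"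
    by (rule emb_diff) auto
  also have "\<dots> = emb a \<oplus> emb b"
    by (simp add: x_mul_add x'_mul_add emb_def add_swap)
  finally show ?thesis .
qed

text \<open>A nonnegative factor preserves the two parts of the difference, whereas a negative one
  would need \<open>(- 1) \<odot> x\<close> to be \<open>x'\<close>. The weights in the integrals
  are measures, hence nonnegative.\<close>

lemma emb_mul:
  assumes "0 \<le> m"
  shows "emb (m * a) = m \<odot> emb a"
proof -
  have "emb (m * a) = emb (m * max a 0 - m * max (- a) 0)"
    by (rule arg_cong[of _ _ emb]) (simp add: max_def)
  also have "\<dots> = (m * max a 0) \<odot> x \<oplus> (m * max (- a) 0) \<odot> x'"
    using assms by (intro emb_diff) auto
  also have "\<dots> = m \<odot> emb a"
    by (simp add: emb_def mul_add mul_mul)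
  finally show ?thesis .
qed

text \<open>The embedded line consists of convex elements, which \<open>P\<close> fixes; so
  \<open>P\<close> disappears from integrals of functions with values on the line.\<close>

lemma P_emb: "P (emb a) = emb a"
proof (rule P_convex)
  show "convex_elt X (emb a)"
    unfolding convex_elt_def
  proof (intro allI impI)
    fix s t :: real assume "0 \<le> s" "0 \<le> t"
    then show "(s + t) \<odot> emb a = s \<odot> emb a \<oplus> t \<odot> emb a"
      by (simp flip: emb_mul emb_add add: distrib_right)
  qed
qed

lemma emb_sum: "finite A \<Longrightarrow> S.F (\<lambda>w. emb (g w)) A = emb (\<Sum>w\<in>A. g w)"
  by (induction A rule: finite_induct) (auto simp: emb_0 emb_add)

lemma h_emb: "h (emb a) (emb b) = \<bar>a - b\<bar>"
proof -
  have pos: "h (emb r) \<theta> = r" if "0 \<le> r" for r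
  proof -
    have "emb r = r \<odot> x"
      using that by (simp add: emb_def max_absorb1 max_absorb2 mul_zero_left add_zero)
    then have "h (emb r) \<theta> = h (r \<odot> x) (r \<odot> \<theta>)"
      by (simp add: mul_zero_right)
    also have "\<dots> = r"
      unfolding h_mul x_unit using that by simp
    finally show ?thesis .
  qed
  have le: "h (emb a) (emb b) = a - b" if "b \<le> a" for a b
  proof -
    \<comment> \<open>Isotropy cancels the common summand \<open>emb b\<close> exactly; nonexpansive
      translation would give only an inequality.\<close>
    have "h (emb a) (emb b) = h (emb (a - b) \<oplus> emb b) (\<theta> \<oplus> emb b)"
      by (simp flip: emb_add emb_0)
    then show ?thesis
      using pos[of "a - b"] that by (simp only: h_add_cancel)
  qed
  show ?thesis
    using le[of a b] le[of b a] by (cases "b \<le> a") (auto simp: h_sym[of "emb a"])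
qed

section \<open>Integrals of functions with values on the line\<close>

lemma BTX_emb:
  assumes m: "\<psi> \<in> borel_measurable (restrict_space lborel T)"
    and C: "\<And>t. t \<in> T \<Longrightarrow> \<bar>\<psi> t\<bar> \<le> C"
  shows "(\<lambda>t. emb (\<psi> t)) \<in> BTX X T"
proof -
  have "bounded_X X T (\<lambda>t. emb (\<psi> t))"
    unfolding bounded_X_def using C h_emb[of _ 0] by (auto simp: emb_0)
  moreover have "measurable_X X T (\<lambda>t. emb (\<psi> t))"
    unfolding measurable_X_def
  proof
    fix y
    have "continuous_on UNIV (\<lambda>r. h (emb r) y)"
    proof (rule lipschitz_on_continuous_on[of 1], rule lipschitz_onI)
      fix a b
      show "dist (h (emb a) y) (h (emb b) y) \<le> 1 * dist a b"
        using h_diff_le[of "emb a" y "emb b"] by (simp add: dist_real_def h_emb)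
    qed simp
    then have "(\<lambda>r. h (emb r) y) \<in> borel_measurable borel"
      by (rule borel_measurable_continuous_onI)
    then show "(\<lambda>t. h (emb (\<psi> t)) y) \<in> borel_measurable (restrict_space lborel T)"
      by (rule measurable_compose[OF m])
  qed
  ultimately show ?thesis
    by (simp add: BTX_def)
qed

lemma simple_integral_emb:
  assumes s: "msimple T s" and T: "compact T"
  shows "SI T (\<lambda>t. emb (s t)) = emb (LINT t:T|lborel. s t)"
proof -
  have "SI T (\<lambda>t. emb (s t)) = S.F (\<lambda>w. emb (measure lborel {t\<in>T. s t = w} * w)) (s ` T)"
    using simple_integral_comp[OF s T, of emb] by (simp add: P_emb emb_mul)
  also have "\<dots> = emb (LINT t:T|lborel. s t)"
    using msimple_set_integral(2)[OF s T, of "\<lambda>r. r"] by (simp add: emb_sum[OF msimple_finite[OF s]])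
  finally show ?thesis .
qed

text \<open>Rounding \<open>\<psi>\<close> down to multiples of \<open>1 / N\<close> gives a simple
  function whose embedded integral is within \<open>measure lborel T / N\<close> of both sides, and
  \<open>N\<close> is arbitrary.\<close>

lemma integral_X_emb:
  fixes \<psi> :: "'a::euclidean_space \<Rightarrow> real"
  assumes m: "\<psi> \<in> borel_measurable (restrict_space lborel T)"
    and C: "\<And>t. t \<in> T \<Longrightarrow> \<bar>\<psi> t\<bar> \<le> C" and T: "compact T"
  shows "integral_X X P T (\<lambda>t. emb (\<psi> t)) = emb (LINT t:T|lborel. \<psi> t)"
proof -
  let ?I = "integral_X X P T (\<lambda>t. emb (\<psi> t))" and ?J = "emb (LINT t:T|lborel. \<psi> t)"
  let ?M = "measure lborel T"
  have Tb: "T \<in> sets borel"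
    by (rule compact_borel[OF T])
  have int\<psi>: "set_integrable lborel T \<psi>"
    using m T C by (rule set_integrable_bounded_compact)
  have bound: "N * h ?I ?J \<le> 2 * ?M" if N: "0 < N" for N :: real
  proof -
    define s where "s t = of_int \<lfloor>N * \<psi> t\<rfloor> / N" for t
    have "msimple T (\<lambda>t. \<lfloor>N * \<psi> t\<rfloor>)"
    proof (rule msimple_floor[OF _ Tb])
      show "(\<lambda>t. N * \<psi> t) \<in> borel_measurable (restrict_space lborel T)"
        using m by simp
      show "\<bar>N * \<psi> t\<bar> \<le> N * C" if "t \<in> T" for t
        using C[OF that] N by (simp add: abs_mult)
    qed
    then have s: "msimple T s"
      unfolding s_def by (rule msimple_comp[of T _ "\<lambda>j. of_int j / N"])
    have ints: "set_integrable lborel T s"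
      using msimple_set_integral(1)[OF s T, of "\<lambda>r. r"] by simp
    have close: "\<bar>\<psi> t - s t\<bar> \<le> 1 / N" for t
    proof -
      have "\<psi> t - s t = (N * \<psi> t - of_int \<lfloor>N * \<psi> t\<rfloor>) / N"
        using N by (simp add: s_def field_simps)
      moreover have "\<bar>N * \<psi> t - of_int \<lfloor>N * \<psi> t\<rfloor>\<bar> \<le> 1"
        by linarith
      ultimately show ?thesis
        using N by (simp add: divide_right_mono)
    qed
    have const: "set_integrable lborel T (\<lambda>_. 1 / N)" "(LINT t:T|lborel. 1 / N) = ?M / N"
      using Tb compact_subset_measure_finite[OF T, of T]
      by (auto simp: set_integrable_def set_lebesgue_integral_def integrable_indicator_iff)
    have diff: "set_integrable lborel T (\<lambda>t. \<psi> t - s t)"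
      by (rule set_integral_diff(1)[OF int\<psi> ints])
    have L1: "(LINT t:T|lborel. \<bar>\<psi> t - s t\<bar>) \<le> ?M / N"
      unfolding const(2)[symmetric]
      by (intro set_integral_mono set_integrable_abs diff const(1) close)
    have "h ?I (SI T (\<lambda>t. emb (s t))) \<le> (LINT t:T|lborel. h (emb (\<psi> t)) (emb (s t)))"
      by (intro h_integral_X_simple BTX_emb[OF m C] msimple_comp[OF s] T)
    also have "\<dots> \<le> ?M / N"
      using L1 by (simp add: h_emb)
    finally have 1: "h ?I (emb (LINT t:T|lborel. s t)) \<le> ?M / N"
      by (simp add: simple_integral_emb[OF s T])
    have "h (emb (LINT t:T|lborel. s t)) ?J = \<bar>LINT t:T|lborel. \<psi> t - s t\<bar>"
      by (simp add: h_emb set_integral_diff(2)[OF int\<psi> ints] abs_minus_commute)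
    also have "\<dots> \<le> (LINT t:T|lborel. \<bar>\<psi> t - s t\<bar>)"
      using set_integral_norm_bound[OF diff] by simp
    finally have 2: "h (emb (LINT t:T|lborel. s t)) ?J \<le> ?M / N"
      using L1 by simp
    have "h ?I ?J \<le> 2 * ?M / N"
      using 1 2 h_triangle[of ?I ?J "emb (LINT t:T|lborel. s t)"] by simp
    then show ?thesis
      using N by (simp add: field_simps)
  qed
  have "h ?I ?J = 0"
  proof (rule ccontr)
    assume "h ?I ?J \<noteq> 0"
    then have pos: "0 < h ?I ?J"
      using h_nonneg[of ?I ?J] by simp
    \<comment> \<open>With this \<open>N\<close> the left side of the bound equals
      \<open>2 * ?M + 1\<close>, which exceeds the right side.\<close>
    then have "2 * ?M + 1 \<le> 2 * ?M"
      using bound[of "(2 * ?M + 1) / h ?I ?J"] by (simp add: add_nonneg_pos)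
    then show False
      by simp
  qed
  then show ?thesis
    by (simp add: h_eq_0)
qed

section \<open>Functions with vanishing information\<close>

lemma emb_H_omega:
  assumes "\<And>s s'. \<bar>\<phi> s - \<phi> s'\<bar> \<le> \<omega> (dist s s')"
  shows "(\<lambda>t. emb (\<phi> t)) \<in> H_omega X \<omega> T"
  using assms by (simp add: H_omega_def h_emb)

lemma info_emb_zero:
  fixes \<phi> :: "'a::euclidean_space \<Rightarrow> real"
  assumes om: "modulus_of_continuity \<omega>" and \<phi>: "\<And>s s'. \<bar>\<phi> s - \<phi> s'\<bar> \<le> \<omega> (dist s s')"
    and T: "compact T" and B: "\<forall>i<n. cball (xs i) e \<subseteq> T"
    and zero: "\<And>i. i < n \<Longrightarrow> integral (cball (xs i) e) \<phi> = 0"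
  shows "info X P T n xs e (\<lambda>t. emb (\<phi> t)) = (\<lambda>i. \<theta>)"
proof
  fix i
  show "info X P T n xs e (\<lambda>t. emb (\<phi> t)) i = \<theta>"
  proof (cases "i < n")
    case True
    let ?B = "cball (xs i) e"
    let ?\<psi> = "\<lambda>t. indicator ?B t * \<phi> t"
    have cont: "continuous_on A \<phi>" for A
      by (rule continuous_on_modulus[OF om \<phi>])
    have "bounded (\<phi> ` T)"
      by (intro compact_imp_bounded compact_continuous_image cont T)
    then obtain C where C: "\<And>t. t \<in> T \<Longrightarrow> \<bar>\<phi> t\<bar> \<le> C"
      by (auto simp: bounded_iff)
    have "integral_on X P T ?B (\<lambda>t. emb (\<phi> t)) = integral_X X P T (\<lambda>t. emb (?\<psi> t))"
      unfolding integral_on_def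
      by (rule arg_cong[of _ _ "integral_X X P T"]) (auto simp: indicator_def emb_0)
    also have "\<dots> = emb (LINT t:T|lborel. ?\<psi> t)"
    proof (rule integral_X_emb[OF _ _ T])
      show "?\<psi> \<in> borel_measurable (restrict_space lborel T)"
        by (intro borel_measurable_times borel_measurable_restrict_lborel cont
            measurable_restrict_space1 borel_measurable_indicator) simp
      show "\<bar>?\<psi> t\<bar> \<le> C" if "t \<in> T" for t
        using C[OF that] by (auto simp: indicator_def)
    qed
    also have "(LINT t:T|lborel. ?\<psi> t) = (LINT t:?B|lborel. \<phi> t)"
    proof -
      have "?B \<subseteq> T"
        using B True by blast
      then show ?thesis
        unfolding set_lebesgue_integral_def
        by (intro Bochner_Integration.integral_cong) (auto simp: indicator_def)
    qed
    also have "\<dots> = integral ?B \<phi>"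
      by (rule set_borel_integral_eq_integral(2))
        (simp only: set_integrable_def borel_integrable_compact[OF compact_cball cont])
    finally show ?thesis
      using True zero by (simp add: info_def emb_0 mul_zero_right)
  qed (simp add: info_def)
qed

text \<open>The functions \<open>emb (\<phi> t)\<close> and \<open>emb (- \<phi> t)\<close> of
  \<open>t\<close> carry the same information, so the method returns one answer for the two; at
  \<open>t\<close> their values lie \<open>2 * \<bar>\<phi> t\<bar>\<close> apart, and the answer
  misses one of them by at least half of that.\<close>

lemma method_error_ge:
  fixes \<phi> :: "'a::euclidean_space \<Rightarrow> real"
  assumes om: "modulus_of_continuity \<omega>" and \<phi>: "\<And>s s'. \<bar>\<phi> s - \<phi> s'\<bar> \<le> \<omega> (dist s s')"
    and T: "compact T" and B: "\<forall>i<n. cball (xs i) e \<subseteq> T"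
    and zero: "\<And>i. i < n \<Longrightarrow> integral (cball (xs i) e) \<phi> = 0" and t: "t \<in> T"
  shows "ereal (\<phi> t) \<le> method_error X P \<omega> T (info X P T n xs e) \<Phi>"
proof -
  let ?f = "\<lambda>t. emb (\<phi> t)" and ?g = "\<lambda>t. emb (- \<phi> t)"
  let ?y = "\<Phi> (\<lambda>i. \<theta>) t"
  have \<phi>': "\<bar>- \<phi> s - - \<phi> s'\<bar> \<le> \<omega> (dist s s')" for s s'
    using \<phi>[of s s'] by (simp add: abs_minus_commute)
  have "info X P T n xs e ?f = (\<lambda>i. \<theta>)"
    by (rule info_emb_zero[OF om \<phi> T B zero])
  moreover have "info X P T n xs e ?g = (\<lambda>i. \<theta>)"
    using zero by (intro info_emb_zero[OF om \<phi>' T B]) simp_all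
  moreover have "ereal (h (P (f t)) (\<Phi> (info X P T n xs e f) t))
      \<le> method_error X P \<omega> T (info X P T n xs e) \<Phi>" if "f \<in> H_omega X \<omega> T" for f
    unfolding method_error_def hB_def
    by (rule SUP_upper2[OF that], rule SUP_upper2[OF t]) simp
  ultimately have f: "ereal (h (emb (\<phi> t)) ?y) \<le> method_error X P \<omega> T (info X P T n xs e) \<Phi>"
    and g: "ereal (h (emb (- \<phi> t)) ?y) \<le> method_error X P \<omega> T (info X P T n xs e) \<Phi>"
    using emb_H_omega[of \<phi> \<omega>, OF \<phi>] emb_H_omega[of "\<lambda>t. - \<phi> t" \<omega>, OF \<phi>'] by (metis P_emb)+
  have "2 * \<phi> t \<le> h (emb (\<phi> t)) (emb (- \<phi> t))"
    by (simp add: h_emb)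
  also have "\<dots> \<le> h (emb (\<phi> t)) ?y + h (emb (- \<phi> t)) ?y"
    using h_triangle[of "emb (\<phi> t)" "emb (- \<phi> t)" ?y] by (simp add: h_sym)
  finally have "\<phi> t \<le> h (emb (\<phi> t)) ?y \<or> \<phi> t \<le> h (emb (- \<phi> t)) ?y"
    by linarith
  then show ?thesis
    using f g by (meson ereal_less_eq(3) order_trans)
qed

text \<open>Point and method are fixed first, and the extremal function is built for that point,
  with \<open>R\<close> the least ball mean. The supremum over points and the infimum over methods
  follow.\<close>

lemma bound_rhs_le_optimal_error:
  fixes T :: "'a::euclidean_space set"
  assumes om: "modulus_of_continuity \<omega>" and T: "compact T" and n: "1 \<le> n"
    and e: "0 < e" and B: "\<forall>i<n. cball (xs i) e \<subseteq> T"
    and sep: "\<And>i j. i < n \<Longrightarrow> j < n \<Longrightarrow> xs i \<noteq> xs j \<Longrightarrow> \<delta> \<le> dist (xs i) (xs j)"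
    and small: "4 * e \<le> \<delta>" "2 * \<omega> (2 * e) \<le> \<omega> (\<delta> / 2)"
  shows "bound_rhs \<omega> T n xs e \<le> optimal_error X P \<omega> T (info X P T n xs e)"
  unfolding bound_rhs_def optimal_error_def
proof (intro SUP_least INF_greatest)
  fix t \<Phi> assume t: "t \<in> T"
  let ?a = "\<lambda>i. 1 / measure lborel (cball (xs i) e) * integral (cball (xs i) e) (\<lambda>s. \<omega> (dist t s))"
  let ?R = "Min (?a ` {..<n})"
  have R: "?R \<le> ?a i" if "i < n" for i
    using that by (intro Min_le) auto
  have "0 \<le> ?R"
  proof -
    have "?R \<in> ?a ` {..<n}"
      using n by (intro Min_in) (auto simp: lessThan_empty_iff)
    moreover have "0 \<le> ?a i" for i
      by (intro mult_nonneg_nonneg integral_nonneg continuous_integrable_on_cball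
          modulus_dist_continuous[OF om]) (auto intro: modulus_nonneg[OF om])
    ultimately show ?thesis
      by auto
  qed
  moreover have "?R * measure lborel (cball p e) \<le> integral (cball p e) (\<lambda>s. \<omega> (dist t s))"
    if p: "p \<in> xs ` {..<n}" for p
  proof -
    obtain i where i: "i < n" "p = xs i"
      using p by auto
    show ?thesis
      using R[OF i(1)] content_cball_pos[OF e, of p] by (simp add: i(2) field_simps)
  qed
  ultimately obtain \<phi> where \<phi>: "\<And>s s'. \<bar>\<phi> s - \<phi> s'\<bar> \<le> \<omega> (dist s s')" "\<phi> t = ?R"
    "\<And>p. p \<in> xs ` {..<n} \<Longrightarrow> integral (cball p e) \<phi> = 0"
    using extremal_function[OF om e, of ?R "xs ` {..<n}" t \<delta>] sep small
    by (smt (verit) imageE lessThan_iff)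
  have "ereal (\<phi> t) \<le> method_error X P \<omega> T (info X P T n xs e) \<Phi>"
    by (rule method_error_ge[OF om \<phi>(1) T B _ t]) (simp add: \<phi>(3))
  then show "ereal ?R \<le> method_error X P \<omega> T (info X P T n xs e) \<Phi>"
    by (simp add: \<phi>(2))
qed

end

lemma (in convexified_L_space) isotropic_line_exists:
  assumes iso: "isotropic X" and ne: "Xinv X \<inter> Xc X \<noteq> {\<theta>}"
  obtains x x' where "isotropic_line X P x x'"
proof -
  \<comment> \<open>The neutral element always belongs to the intersection, so differing from the
    singleton means containing another element.\<close>
  have "\<theta> \<in> Xinv X \<inter> Xc X"
    by (auto simp: Xinv_def Xc_def invertible_elt_def convex_elt_def mul_zero_right add_zero
        intro!: exI[of _ \<theta>])
  then obtain y y' where y: "y \<noteq> \<theta>" "convex_elt X y" "y \<oplus> y' = \<theta>"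
    using ne by (auto simp: Xinv_def Xc_def invertible_elt_def)
  define r where "r = 1 / h y \<theta>"
  have hy: "0 < h y \<theta>"
    using y(1) h_nonneg[of y \<theta>] h_eq_0[of y \<theta>] by simp
  have "isotropic_line X P (r \<odot> y) (r \<odot> y')"
  proof
    show "convex_elt X (r \<odot> y)"
      unfolding convex_elt_def
    proof (intro allI impI)
      fix a b :: real assume ab: "0 \<le> a" "0 \<le> b"
      have "(a + b) \<odot> (r \<odot> y) = r \<odot> ((a + b) \<odot> y)"
        by (simp add: mul_mul mult.commute)
      also have "\<dots> = r \<odot> (a \<odot> y) \<oplus> r \<odot> (b \<odot> y)"
        using y(2) ab by (simp add: convex_elt_def mul_add)
      finally show "(a + b) \<odot> (r \<odot> y) = a \<odot> (r \<odot> y) \<oplus> b \<odot> (r \<odot> y)"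
        by (simp add: mul_mul mult.commute)
    qed
    show "r \<odot> y \<oplus> r \<odot> y' = \<theta>"
      by (metis mul_add mul_zero_right y(3))
    have "h (r \<odot> y) \<theta> = \<bar>r\<bar> * h y \<theta>"
      using h_mul[of r y \<theta>] by (simp add: mul_zero_right)
    then show "h (r \<odot> y) \<theta> = 1"
      using hy by (simp add: r_def)
  qed (rule iso)
  then show ?thesis
    by (rule that)
qed

section \<open>Combination of the upper and lower bounds\<close>

theorem theorem6:
  fixes X :: "'x slspace" and P :: "'x \<Rightarrow> 'x" and \<omega> :: "real \<Rightarrow> real"
    and T :: "'a::euclidean_space set" and n :: nat and xs :: "nat \<Rightarrow> 'a"
  assumes LX: "L_space X" and PX: "convexifying X P"
    and Tconv: "convex T" and Tcomp: "compact T"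
    and om: "modulus_of_continuity \<omega>"
    and n1: "n \<ge> 1" and xsT: "\<forall>i<n. xs i \<in> T"
  shows "(\<forall>eps>0. (\<forall>i<n. cball (xs i) eps \<subseteq> T) \<longrightarrow>
            optimal_error X P \<omega> T (info X P T n xs eps) \<le> bound_rhs \<omega> T n xs eps)
       \<and> ((isotropic X \<and> Xinv X \<inter> Xc X \<noteq> {szero X}) \<longrightarrow>
           (\<exists>eps0>0. \<forall>eps. 0 < eps \<and> eps < eps0 \<and> (\<forall>i<n. cball (xs i) eps \<subseteq> T) \<longrightarrow>
              optimal_error X P \<omega> T (info X P T n xs eps) = bound_rhs \<omega> T n xs eps
            \<and> Phi_star X T n xs \<in> methods X T
            \<and> method_error X P \<omega> T (info X P T n xs eps) (Phi_star X T n xs)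
                = optimal_error X P \<omega> T (info X P T n xs eps)))"
proof -
  interpret convexified_L_space X P
    using LX PX by unfold_locales
  note Phi_mem = Phi_star_methods[OF Tcomp, of n xs]
  have opt_le: "optimal_error X P \<omega> T (info X P T n xs e)
      \<le> method_error X P \<omega> T (info X P T n xs e) (Phi_star X T n xs)" for e
    unfolding optimal_error_def by (rule INF_lower[OF Phi_mem])
  have upper: "method_error X P \<omega> T (info X P T n xs e) (Phi_star X T n xs) \<le> bound_rhs \<omega> T n xs e"
    if "0 < e" "\<forall>i<n. cball (xs i) e \<subseteq> T" for e
    by (rule Phi_star_error[OF om Tcomp n1 that])
  have "\<exists>eps0>0. \<forall>eps. 0 < eps \<and> eps < eps0 \<and> (\<forall>i<n. cball (xs i) eps \<subseteq> T) \<longrightarrow>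
      optimal_error X P \<omega> T (info X P T n xs eps) = bound_rhs \<omega> T n xs eps
      \<and> Phi_star X T n xs \<in> methods X T
      \<and> method_error X P \<omega> T (info X P T n xs eps) (Phi_star X T n xs)
          = optimal_error X P \<omega> T (info X P T n xs eps)"
    if iso: "isotropic X" "Xinv X \<inter> Xc X \<noteq> {szero X}"
  proof -
    obtain x x' where "isotropic_line X P x x'"
      using isotropic_line_exists[OF iso] by blast
    then interpret isotropic_line X P x x' .
    obtain \<delta> where \<delta>: "0 < \<delta>" "\<And>i j. i < n \<Longrightarrow> j < n \<Longrightarrow> xs i \<noteq> xs j \<Longrightarrow> \<delta> \<le> dist (xs i) (xs j)"
      using finite_points_separated by blast
    \<comment> \<open>The threshold comes from the sample points and from \<omega> alone, so it is
      fixed before the radius.\<close>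
    obtain \<eta> where \<eta>: "0 < \<eta>"
      "\<And>e. 0 < e \<Longrightarrow> e < \<eta> \<Longrightarrow> 4 * e \<le> \<delta> \<and> 2 * \<omega> (2 * e) \<le> \<omega> (\<delta> / 2)"
      using modulus_small[OF om \<delta>(1)] by blast
    have lower: "bound_rhs \<omega> T n xs e \<le> optimal_error X P \<omega> T (info X P T n xs e)"
      if "0 < e" "e < \<eta>" "\<forall>i<n. cball (xs i) e \<subseteq> T" for e
      using \<eta>(2)[OF that(1,2)] by (intro bound_rhs_le_optimal_error[OF om Tcomp n1 that(1,3) \<delta>(2)]) auto
    show ?thesis
    proof (intro exI[of _ \<eta>] conjI allI impI \<eta>(1) Phi_mem; elim conjE)
      fix e assume e: "0 < e" "e < \<eta>" "\<forall>i<n. cball (xs i) e \<subseteq> T"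
      \<comment> \<open>The optimal error, the error of \<open>Phi_star\<close> and the bound form a
        closed cycle of inequalities, so all three coincide.\<close>
      note chain = opt_le[of e] upper[OF e(1,3)] lower[OF e]
      then show "optimal_error X P \<omega> T (info X P T n xs e) = bound_rhs \<omega> T n xs e"
        and "method_error X P \<omega> T (info X P T n xs e) (Phi_star X T n xs)
          = optimal_error X P \<omega> T (info X P T n xs e)"
        by auto
    qed
  qed
  then show ?thesis
    using opt_le upper by (blast intro: order_trans)
qed

end
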